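(* Consider $G\ge 2$ treatment levels with potential outcomes $Y(1),\dots,Y(G)$, assignment indicators $\mathbf{W}=(W_1,\dots,W_G)$ (each $W_g\in\{0,1\}$, $W_1+\cdots+W_G=1$) with $\rho_g=\mathbb{P}(W_g=1)>0$, and a $1\times K$ covariate vector $\mathbf{X}$. Assume $\mathbf{W}$ is independent of $(Y(1),\dots,Y(G),\mathbf{X})$, the data $\{(\mathbf{W}_i,Y_i(1),\dots,Y_i(G),\mathbf{X}_i)\}_{i=1}^N$ are i.i.d. for a nonrandom $N$, and second moments are finite. Observed outcome $Y_i=\sum_g W_{ig}Y_i(g)$. Let $\check{\boldsymbol\mu}$ be the $G\times1$ vector of OLS coefficients on $\mathbf{W}_i=(W_{i1},\dots,W_{iG})$ in the regression of $Y_i$ on $\mathbf{W}_i,\ddot{\mathbf{X}}_i$ ($i=1,\dots,N$), where $\ddot{\mathbf{X}}_i=\mathbf{X}_i-\bar{\mathbf{X}}$ and $\bar{\mathbf{X}}=N^{-1}\sum_i\mathbf{X}_i$. Then $$\sqrt N(\check{\boldsymbol\mu}-\boldsymbol\mu)=N^{-1/2}\sum_{i=1}^N(\mathbf{F}_i+\mathbf{K}_i+\mathbf{Q}_i)+o_p(1),$$ where, with $\boldsymbol\delta_g=\boldsymbol\beta_g-\boldsymbol\beta$, $\mathbf{F}_i$ has $g$-th entry $\rho_g^{-1}(W_{ig}-\rho_g)\dot{\mathbf{X}}_i\boldsymbol\delta_g$, $\mathbf{K}_i$ has $g$-th entry $\dot{\mathbf{X}}_i\boldsymbol\beta_g$,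 and $\mathbf{Q}_i$ has $g$-th entry $W_{ig}U_i(g)/\rho_g$.
   Context: $\mu_g=\mathbb{E}[Y(g)]$, $\boldsymbol\mu=(\mu_1,\dots,\mu_G)'$, $\boldsymbol\mu_{\mathbf{X}}=\mathbb{E}(\mathbf{X})$, $\dot{\mathbf{X}}=\mathbf{X}-\boldsymbol\mu_{\mathbf{X}}$. For each $g$, $\boldsymbol\beta_g$ is the coefficient vector of the population linear projection of $Y(g)-\mu_g$ onto $\dot{\mathbf{X}}$, and $U(g)=Y(g)-\mu_g-\dot{\mathbf{X}}\boldsymbol\beta_g$. $\boldsymbol\beta$ denotes the coefficient vector of the population linear projection of the observed outcome $Y$ onto $\dot{\mathbf{X}}$ (which equals $\sum_g\rho_g\boldsymbol\beta_g$). Subscript $i$ denotes the quantity for the $i$-th draw. *)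

theory Defs
  imports "HOL-Probability.Probability"
begin

text \<open>A draw is a triple (W, Y, X): W :: real^'g is the vector of assignment indicators,
  Y :: real^'g the vector of potential outcomes (Y(1),...,Y(G)), X :: real^'k the covariates.
  Z i is the i-th draw (i = 0, 1, 2, ...); draw 0 is used for population quantities.\<close>

type_synonym ('g,'k) draw = "(real^'g) \<times> (real^'g) \<times> (real^'k)"

definition Wv :: "(nat \<Rightarrow> 'a \<Rightarrow> ('g::finite,'k::finite) draw) \<Rightarrow> nat \<Rightarrow> 'a \<Rightarrow> real^'g" where
  "Wv Z i \<omega> = fst (Z i \<omega>)"

definition Yv :: "(nat \<Rightarrow> 'a \<Rightarrow> ('g::finite,'k::finite) draw) \<Rightarrow> nat \<Rightarrow> 'a \<Rightarrow> real^'g" where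
  "Yv Z i \<omega> = fst (snd (Z i \<omega>))"

definition Xv :: "(nat \<Rightarrow> 'a \<Rightarrow> ('g::finite,'k::finite) draw) \<Rightarrow> nat \<Rightarrow> 'a \<Rightarrow> real^'k" where
  "Xv Z i \<omega> = snd (snd (Z i \<omega>))"

definition Yobs :: "(nat \<Rightarrow> 'a \<Rightarrow> ('g::finite,'k::finite) draw) \<Rightarrow> nat \<Rightarrow> 'a \<Rightarrow> real" where
  "Yobs Z i \<omega> = (\<Sum>g\<in>UNIV. Wv Z i \<omega> $ g * Yv Z i \<omega> $ g)"

definition muY :: "'a measure \<Rightarrow> (nat \<Rightarrow> 'a \<Rightarrow> ('g::finite,'k::finite) draw) \<Rightarrow> real^'g" where
  "muY M Z = (\<chi> g. integral\<^sup>L M (\<lambda>\<omega>. Yv Z 0 \<omega> $ g))"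

definition muX :: "'a measure \<Rightarrow> (nat \<Rightarrow> 'a \<Rightarrow> ('g::finite,'k::finite) draw) \<Rightarrow> real^'k" where
  "muX M Z = integral\<^sup>L M (\<lambda>\<omega>. Xv Z 0 \<omega>)"

definition Xdot :: "'a measure \<Rightarrow> (nat \<Rightarrow> 'a \<Rightarrow> ('g::finite,'k::finite) draw) \<Rightarrow> nat \<Rightarrow> 'a \<Rightarrow> real^'k" where
  "Xdot M Z i \<omega> = Xv Z i \<omega> - muX M Z"

definition rho :: "'a measure \<Rightarrow> (nat \<Rightarrow> 'a \<Rightarrow> ('g::finite,'k::finite) draw) \<Rightarrow> 'g \<Rightarrow> real" where
  "rho M Z g = measure M {\<omega> \<in> space M. Wv Z 0 \<omega> $ g = 1}"

definition betag :: "'a measure \<Rightarrow> (nat \<Rightarrow> 'a \<Rightarrow> ('g::finite,'k::finite) draw) \<Rightarrow> 'g \<Rightarrow> real^'k" where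
  "betag M Z g = (SOME b. \<forall>b'.
     integral\<^sup>L M (\<lambda>\<omega>. (Yv Z 0 \<omega> $ g - muY M Z $ g - Xdot M Z 0 \<omega> \<bullet> b)\<^sup>2)
     \<le> integral\<^sup>L M (\<lambda>\<omega>. (Yv Z 0 \<omega> $ g - muY M Z $ g - Xdot M Z 0 \<omega> \<bullet> b')\<^sup>2))"

definition betaobs :: "'a measure \<Rightarrow> (nat \<Rightarrow> 'a \<Rightarrow> ('g::finite,'k::finite) draw) \<Rightarrow> real^'k" where
  "betaobs M Z = (SOME b. \<forall>b'.
     integral\<^sup>L M (\<lambda>\<omega>. (Yobs Z 0 \<omega> - Xdot M Z 0 \<omega> \<bullet> b)\<^sup>2)
     \<le> integral\<^sup>L M (\<lambda>\<omega>. (Yobs Z 0 \<omega> - Xdot M Z 0 \<omega> \<bullet> b')\<^sup>2))"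

definition Uerr :: "'a measure \<Rightarrow> (nat \<Rightarrow> 'a \<Rightarrow> ('g::finite,'k::finite) draw) \<Rightarrow> 'g \<Rightarrow> nat \<Rightarrow> 'a \<Rightarrow> real" where
  "Uerr M Z g i \<omega> = Yv Z i \<omega> $ g - muY M Z $ g - Xdot M Z i \<omega> \<bullet> betag M Z g"

definition Xddot :: "(nat \<Rightarrow> 'a \<Rightarrow> ('g::finite,'k::finite) draw) \<Rightarrow> nat \<Rightarrow> nat \<Rightarrow> 'a \<Rightarrow> real^'k" where
  "Xddot Z N i \<omega> = Xv Z i \<omega> - (1 / real N) *\<^sub>R (\<Sum>j<N. Xv Z j \<omega>)"

definition SSR :: "(nat \<Rightarrow> 'a \<Rightarrow> ('g::finite,'k::finite) draw) \<Rightarrow> nat \<Rightarrow> 'a \<Rightarrow> real^'g \<Rightarrow> real^'k \<Rightarrow> real" where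
  "SSR Z N \<omega> m b = (\<Sum>i<N. (Yobs Z i \<omega> - Wv Z i \<omega> \<bullet> m - Xddot Z N i \<omega> \<bullet> b)\<^sup>2)"

definition ols_mu :: "(nat \<Rightarrow> 'a \<Rightarrow> ('g::finite,'k::finite) draw) \<Rightarrow> nat \<Rightarrow> 'a \<Rightarrow> real^'g" where
  "ols_mu Z N \<omega> = fst (SOME mb. \<forall>m' b'. SSR Z N \<omega> (fst mb) (snd mb) \<le> SSR Z N \<omega> m' b')"

definition Fv :: "'a measure \<Rightarrow> (nat \<Rightarrow> 'a \<Rightarrow> ('g::finite,'k::finite) draw) \<Rightarrow> nat \<Rightarrow> 'a \<Rightarrow> real^'g" where
  "Fv M Z i \<omega> = (\<chi> g. (Wv Z i \<omega> $ g - rho M Z g) / rho M Z g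
                      * (Xdot M Z i \<omega> \<bullet> (betag M Z g - betaobs M Z)))"

definition Kv :: "'a measure \<Rightarrow> (nat \<Rightarrow> 'a \<Rightarrow> ('g::finite,'k::finite) draw) \<Rightarrow> nat \<Rightarrow> 'a \<Rightarrow> real^'g" where
  "Kv M Z i \<omega> = (\<chi> g. Xdot M Z i \<omega> \<bullet> betag M Z g)"

definition Qv :: "'a measure \<Rightarrow> (nat \<Rightarrow> 'a \<Rightarrow> ('g::finite,'k::finite) draw) \<Rightarrow> nat \<Rightarrow> 'a \<Rightarrow> real^'g" where
  "Qv M Z i \<omega> = (\<chi> g. Wv Z i \<omega> $ g * Uerr M Z g i \<omega> / rho M Z g)"

text \<open>o_p(1): convergence to 0 in (outer) probability; the outer form avoids any
  dependence on measurability of the sequence.\<close>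
definition op1 :: "'a measure \<Rightarrow> (nat \<Rightarrow> 'a \<Rightarrow> 'b::real_normed_vector) \<Rightarrow> bool" where
  "op1 M V \<longleftrightarrow> (\<forall>\<epsilon>>0. \<forall>\<delta>>0. \<exists>N0. \<forall>n\<ge>N0. \<exists>A\<in>sets M.
      {\<omega> \<in> space M. \<epsilon> < norm (V n \<omega>)} \<subseteq> A \<and> measure M A < \<delta>)"

end

theory Submission
  imports Defs
begin

text \<open>Because the indicators sum to one, recentring the covariates at the sample mean instead of the
  population mean only shifts the coefficients on \<open>W\<close> by \<open>Xdotbar \<bullet> b\<close>, so the estimator comes
  from least squares on the i.i.d. regressors \<open>(W, Xdot)\<close>, whose population coefficients are
  \<open>(\<mu>, \<beta>)\<close> with residual \<open>e\<close>. The \<open>\<beta>\<^sub>g\<close> cancel in \<open>F + K + Q\<close>, whose \<open>g\<close>-th entry is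
  \<open>W\<^sub>g e / \<rho>\<^sub>g + Xdot \<bullet> \<beta>\<close>. Writing \<open>p\<^sub>g\<close> for the sample share of group \<open>g\<close>, the normal equation
  for \<open>W\<^sub>g\<close> shows that the remainder is, exactly,
  \<open>(1/p\<^sub>g - 1/\<rho>\<^sub>g) N\<^bsup>-1/2\<^esup> \<Sum> W\<^sub>g e + N\<^bsup>-1/2\<^esup> \<Sum> (1 - W\<^sub>g/p\<^sub>g) Xdot \<bullet> (b - \<beta>)\<close>.
  The normalized sums have mean-zero summands with finite variance and so are bounded in probability;
  \<open>p\<^sub>g \<rightarrow> \<rho>\<^sub>g\<close> and \<open>b \<rightarrow> \<beta>\<close> in probability by the weak law of large numbers. The covariance of
  \<open>Xdot\<close> may be singular; \<open>b\<close> is then consistent modulo directions along which \<open>Xdot\<close> vanishes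
  almost surely, and these do not contribute.\<close>

subsection \<open>Stochastic order symbols\<close>

definition outer_less :: "'a measure \<Rightarrow> ('a \<Rightarrow> bool) \<Rightarrow> real \<Rightarrow> bool" where
  "outer_less M P \<delta> \<longleftrightarrow> (\<exists>A\<in>sets M. {\<omega> \<in> space M. P \<omega>} \<subseteq> A \<and> measure M A < \<delta>)"

definition Op1 :: "'a measure \<Rightarrow> (nat \<Rightarrow> 'a \<Rightarrow> 'b::real_normed_vector) \<Rightarrow> bool" where
  "Op1 M V \<longleftrightarrow> (\<forall>\<delta>>0. \<exists>C>0. \<forall>\<^sub>F n in sequentially. outer_less M (\<lambda>\<omega>. C < norm (V n \<omega>)) \<delta>)"

lemma op1_iff:
  "op1 M V \<longleftrightarrow>
     (\<forall>\<epsilon>>0. \<forall>\<delta>>0. \<forall>\<^sub>F n in sequentially. outer_less M (\<lambda>\<omega>. \<epsilon> < norm (V n \<omega>)) \<delta>)"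
  by (auto simp: op1_def outer_less_def eventually_sequentially)

lemma op1I:
  "(\<And>\<epsilon> \<delta>. \<epsilon> > 0 \<Longrightarrow> \<delta> > 0 \<Longrightarrow>
      \<forall>\<^sub>F n in sequentially. outer_less M (\<lambda>\<omega>. \<epsilon> < norm (V n \<omega>)) \<delta>) \<Longrightarrow> op1 M V"
  by (simp add: op1_iff)

lemma op1D:
  "op1 M V \<Longrightarrow> \<epsilon> > 0 \<Longrightarrow> \<delta> > 0 \<Longrightarrow>
     \<forall>\<^sub>F n in sequentially. outer_less M (\<lambda>\<omega>. \<epsilon> < norm (V n \<omega>)) \<delta>"
  by (simp add: op1_iff)

context prob_space
begin

lemma outer_less_AE_mono:
  assumes "outer_less M Q \<delta>" "AE \<omega> in M. P \<omega> \<longrightarrow> Q \<omega>"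
  shows "outer_less M P \<delta>"
proof -
  obtain A where A: "A \<in> sets M" "{\<omega> \<in> space M. Q \<omega>} \<subseteq> A" "measure M A < \<delta>"
    using assms(1) by (auto simp: outer_less_def)
  obtain N where N: "{\<omega> \<in> space M. \<not> (P \<omega> \<longrightarrow> Q \<omega>)} \<subseteq> N" "N \<in> sets M" "emeasure M N = 0"
    using assms(2) by (auto elim!: AE_E)
  have "measure M (A \<union> N) \<le> measure M A + measure M N"
    using A N by (intro measure_Un_le) auto
  also have "measure M N = 0" using N by (simp add: measure_def)
  finally show ?thesis
    unfolding outer_less_def using A N by (intro bexI[of _ "A \<union> N"]) auto
qed

lemma outer_less_disj:
  assumes "outer_less M P \<delta>" "outer_less M Q \<delta>'"
  shows "outer_less M (\<lambda>\<omega>. P \<omega> \<or> Q \<omega>) (\<delta> + \<delta>')"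
proof -
  obtain A B where "A \<in> sets M" "{\<omega> \<in> space M. P \<omega>} \<subseteq> A" "measure M A < \<delta>"
    "B \<in> sets M" "{\<omega> \<in> space M. Q \<omega>} \<subseteq> B" "measure M B < \<delta>'"
    using assms by (auto simp: outer_less_def)
  moreover from this have "measure M (A \<union> B) \<le> measure M A + measure M B"
    by (intro measure_Un_le) auto
  ultimately show ?thesis
    unfolding outer_less_def by (intro bexI[of _ "A \<union> B"]) auto
qed

lemma outer_less_disj_half:
  assumes "outer_less M P (\<delta>/2)" "outer_less M Q (\<delta>/2)" "AE \<omega> in M. R \<omega> \<longrightarrow> P \<omega> \<or> Q \<omega>"
  shows "outer_less M R \<delta>"
  using outer_less_AE_mono[OF outer_less_disj[OF assms(1,2)] assms(3)] by simp

lemma op1_AE_mono: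
  assumes "op1 M V'" "op1 M D" "c > 0"
    and le: "AE \<omega> in M. \<forall>n>0. norm (D n \<omega>) < c \<longrightarrow> norm (V n \<omega>) \<le> norm (V' n \<omega>)"
  shows "op1 M V"
proof (rule op1I)
  fix \<epsilon> \<delta> :: real assume pos: "\<epsilon> > 0" "\<delta> > 0"
  have "\<forall>\<^sub>F n in sequentially. outer_less M (\<lambda>\<omega>. \<epsilon> < norm (V' n \<omega>)) (\<delta>/2)"
    using op1D[OF assms(1) pos(1), of "\<delta>/2"] pos by simp
  moreover have "\<forall>\<^sub>F n in sequentially. outer_less M (\<lambda>\<omega>. c/2 < norm (D n \<omega>)) (\<delta>/2)"
    using op1D[OF assms(2), of "c/2" "\<delta>/2"] pos \<open>c > 0\<close> by simp
  ultimately show "\<forall>\<^sub>F n in sequentially. outer_less M (\<lambda>\<omega>. \<epsilon> < norm (V n \<omega>)) \<delta>"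
    using eventually_gt_at_top[of 0]
  proof eventually_elim
    case (elim n)
    have "AE \<omega> in M. \<epsilon> < norm (V n \<omega>) \<longrightarrow> \<epsilon> < norm (V' n \<omega>) \<or> c/2 < norm (D n \<omega>)"
      using le
    proof eventually_elim
      case el: (elim \<omega>)
      then have "norm (D n \<omega>) < c \<longrightarrow> norm (V n \<omega>) \<le> norm (V' n \<omega>)"
        using \<open>0 < n\<close> by blast
      then show ?case using \<open>c > 0\<close> by force
    qed
    with elim(1,2) show ?case by (rule outer_less_disj_half)
  qed
qed

lemma op1_zero: "op1 M (\<lambda>n \<omega>. 0)"
  by (auto simp: op1_def intro!: bexI[of _ "{}"])

lemma op1_mono:
  assumes "op1 M V'" "\<And>n \<omega>. norm (V n \<omega>) \<le> norm (V' n \<omega>)"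
  shows "op1 M V"
  by (rule op1_AE_mono[OF assms(1) op1_zero zero_less_one]) (use assms(2) in simp)

lemma op1_add:
  assumes "op1 M V" "op1 M V'"
  shows "op1 M (\<lambda>n \<omega>. V n \<omega> + V' n \<omega>)"
proof (rule op1I)
  fix \<epsilon> \<delta> :: real assume pos: "\<epsilon> > 0" "\<delta> > 0"
  have "\<forall>\<^sub>F n in sequentially. outer_less M (\<lambda>\<omega>. \<epsilon>/2 < norm (V n \<omega>)) (\<delta>/2)"
    using op1D[OF assms(1), of "\<epsilon>/2" "\<delta>/2"] pos by simp
  moreover have "\<forall>\<^sub>F n in sequentially. outer_less M (\<lambda>\<omega>. \<epsilon>/2 < norm (V' n \<omega>)) (\<delta>/2)"
    using op1D[OF assms(2), of "\<epsilon>/2" "\<delta>/2"] pos by simp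
  ultimately show "\<forall>\<^sub>F n in sequentially. outer_less M (\<lambda>\<omega>. \<epsilon> < norm (V n \<omega> + V' n \<omega>)) \<delta>"
  proof eventually_elim
    case (elim n)
    then show ?case
    proof (rule outer_less_disj_half, intro AE_I2 impI)
      fix \<omega> assume "\<epsilon> < norm (V n \<omega> + V' n \<omega>)"
      then show "\<epsilon>/2 < norm (V n \<omega>) \<or> \<epsilon>/2 < norm (V' n \<omega>)"
        using norm_triangle_ineq[of "V n \<omega>" "V' n \<omega>"] by argo
    qed
  qed
qed

lemma op1_sum:
  assumes "\<And>i. i \<in> I \<Longrightarrow> op1 M (V i)"
  shows "op1 M (\<lambda>n \<omega>. \<Sum>i\<in>I. V i n \<omega>)"
  using assms by (induction I rule: infinite_finite_induct) (auto intro: op1_zero op1_add)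

lemma op1_abs:
  fixes V :: "nat \<Rightarrow> 'a \<Rightarrow> real"
  assumes "op1 M V" shows "op1 M (\<lambda>n \<omega>. \<bar>V n \<omega>\<bar>)"
  by (rule op1_mono[OF assms]) simp

lemma Op1_mono:
  assumes "Op1 M V'" "\<And>n \<omega>. norm (V n \<omega>) \<le> norm (V' n \<omega>)"
  shows "Op1 M V"
  unfolding Op1_def
proof (intro allI impI)
  fix \<delta> :: real assume "\<delta> > 0"
  then obtain C where C: "C > 0" "\<forall>\<^sub>F n in sequentially. outer_less M (\<lambda>\<omega>. C < norm (V' n \<omega>)) \<delta>"
    using assms(1) by (auto simp: Op1_def)
  have "\<forall>\<^sub>F n in sequentially. outer_less M (\<lambda>\<omega>. C < norm (V n \<omega>)) \<delta>"
    using C(2) by eventually_elim (erule outer_less_AE_mono, use assms(2) in \<open>auto intro: less_le_trans\<close>)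
  then show "\<exists>C>0. \<forall>\<^sub>F n in sequentially. outer_less M (\<lambda>\<omega>. C < norm (V n \<omega>)) \<delta>"
    using C(1) by blast
qed

lemma Op1_const: "Op1 M (\<lambda>n \<omega>. c)"
proof -
  have "outer_less M (\<lambda>\<omega>. norm c + 1 < norm c) \<delta>" if "\<delta> > 0" for \<delta>
    using that by (auto simp: outer_less_def intro!: bexI[of _ "{}"])
  then show ?thesis
    unfolding Op1_def by (intro allI impI exI[of _ "norm c + 1"]) (auto simp: add_nonneg_pos)
qed

lemma Op1_add:
  assumes "Op1 M V" "Op1 M V'"
  shows "Op1 M (\<lambda>n \<omega>. V n \<omega> + V' n \<omega>)"
  unfolding Op1_def
proof (intro allI impI)
  fix \<delta> :: real assume "\<delta> > 0"
  then have d: "\<delta>/2 > 0" by simp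
  obtain C where C: "C > 0" "\<forall>\<^sub>F n in sequentially. outer_less M (\<lambda>\<omega>. C < norm (V n \<omega>)) (\<delta>/2)"
    using assms(1) d unfolding Op1_def by blast
  obtain C' where C': "C' > 0" "\<forall>\<^sub>F n in sequentially. outer_less M (\<lambda>\<omega>. C' < norm (V' n \<omega>)) (\<delta>/2)"
    using assms(2) d unfolding Op1_def by blast
  have "\<forall>\<^sub>F n in sequentially. outer_less M (\<lambda>\<omega>. C + C' < norm (V n \<omega> + V' n \<omega>)) \<delta>"
    using C(2) C'(2)
  proof eventually_elim
    case (elim n)
    then show ?case
    proof (rule outer_less_disj_half, intro AE_I2 impI)
      fix \<omega> assume "C + C' < norm (V n \<omega> + V' n \<omega>)"
      then show "C < norm (V n \<omega>) \<or> C' < norm (V' n \<omega>)"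
        using norm_triangle_ineq[of "V n \<omega>" "V' n \<omega>"] by argo
    qed
  qed
  then show "\<exists>C>0. \<forall>\<^sub>F n in sequentially. outer_less M (\<lambda>\<omega>. C < norm (V n \<omega> + V' n \<omega>)) \<delta>"
    using C(1) C'(1) by (intro exI[of _ "C + C'"]) auto
qed

lemma Op1_sum:
  assumes "\<And>i. i \<in> I \<Longrightarrow> Op1 M (V i)"
  shows "Op1 M (\<lambda>n \<omega>. \<Sum>i\<in>I. V i n \<omega>)"
  using assms by (induction I rule: infinite_finite_induct) (auto intro: Op1_const Op1_add)

lemma Op1_abs:
  fixes V :: "nat \<Rightarrow> 'a \<Rightarrow> real"
  assumes "Op1 M V" shows "Op1 M (\<lambda>n \<omega>. \<bar>V n \<omega>\<bar>)"
  by (rule Op1_mono[OF assms]) simp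

lemma op1_mult_Op1:
  fixes V V' :: "nat \<Rightarrow> 'a \<Rightarrow> real"
  assumes "op1 M V" "Op1 M V'"
  shows "op1 M (\<lambda>n \<omega>. V n \<omega> * V' n \<omega>)"
proof (rule op1I)
  fix \<epsilon> \<delta> :: real assume pos: "\<epsilon> > 0" "\<delta> > 0"
  then have d: "\<delta>/2 > 0" by simp
  obtain C where C: "C > 0" "\<forall>\<^sub>F n in sequentially. outer_less M (\<lambda>\<omega>. C < norm (V' n \<omega>)) (\<delta>/2)"
    using assms(2) d unfolding Op1_def by blast
  have "\<forall>\<^sub>F n in sequentially. outer_less M (\<lambda>\<omega>. \<epsilon>/C < norm (V n \<omega>)) (\<delta>/2)"
    using op1D[OF assms(1), of "\<epsilon>/C" "\<delta>/2"] pos C(1) by simp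
  then show "\<forall>\<^sub>F n in sequentially. outer_less M (\<lambda>\<omega>. \<epsilon> < norm (V n \<omega> * V' n \<omega>)) \<delta>"
    using C(2)
  proof eventually_elim
    case (elim n)
    then show ?case
    proof (rule outer_less_disj_half, intro AE_I2 impI)
      fix \<omega> assume *: "\<epsilon> < norm (V n \<omega> * V' n \<omega>)"
      show "\<epsilon>/C < norm (V n \<omega>) \<or> C < norm (V' n \<omega>)"
      proof (rule ccontr)
        assume "\<not> ?thesis"
        then have "norm (V n \<omega>) * norm (V' n \<omega>) \<le> \<epsilon>/C * C"
          using pos C(1) by (intro mult_mono) auto
        then show False using * C(1) by (simp add: abs_mult)
      qed
    qed
  qed
qed

lemma Op1_cmult:
  fixes V :: "nat \<Rightarrow> 'a \<Rightarrow> real"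
  assumes "Op1 M V" shows "Op1 M (\<lambda>n \<omega>. c * V n \<omega>)"
  unfolding Op1_def
proof (intro allI impI)
  fix \<delta> :: real assume "\<delta> > 0"
  then obtain C where C: "C > 0" "\<forall>\<^sub>F n in sequentially. outer_less M (\<lambda>\<omega>. C < norm (V n \<omega>)) \<delta>"
    using assms(1) by (auto simp: Op1_def)
  have *: "C < norm x" if "(\<bar>c\<bar> + 1) * C < norm (c * x)" for x
  proof (rule ccontr)
    assume "\<not> C < norm x"
    then have "\<bar>c\<bar> * norm x \<le> (\<bar>c\<bar> + 1) * C" by (intro mult_mono) auto
    then show False using that by (simp add: abs_mult)
  qed
  have "\<forall>\<^sub>F n in sequentially. outer_less M (\<lambda>\<omega>. (\<bar>c\<bar> + 1) * C < norm (c * V n \<omega>)) \<delta>"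
    using C(2) by eventually_elim (erule outer_less_AE_mono, use * in \<open>force intro: AE_I2\<close>)
  then show "\<exists>C>0. \<forall>\<^sub>F n in sequentially. outer_less M (\<lambda>\<omega>. C < norm (c * V n \<omega>)) \<delta>"
    using C(1) by (intro exI[of _ "(\<bar>c\<bar> + 1) * C"]) auto
qed

lemma op1_cmult:
  fixes V :: "nat \<Rightarrow> 'a \<Rightarrow> real"
  assumes "op1 M V" shows "op1 M (\<lambda>n \<omega>. c * V n \<omega>)"
  using op1_mult_Op1[OF assms Op1_const[of c]] by (simp add: mult.commute)

lemma expectation_sum_square:
  fixes X :: "nat \<Rightarrow> 'a \<Rightarrow> real"
  assumes ind: "indep_vars (\<lambda>_. borel) X UNIV"
    and sq: "\<And>i. integrable M (\<lambda>\<omega>. (X i \<omega>)\<^sup>2)" and mean: "\<And>i. expectation (X i) = 0"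
  shows "integrable M (\<lambda>\<omega>. (\<Sum>i<n. X i \<omega>)\<^sup>2)"
    and "expectation (\<lambda>\<omega>. (\<Sum>i<n. X i \<omega>)\<^sup>2) = (\<Sum>i<n. expectation (\<lambda>\<omega>. (X i \<omega>)\<^sup>2))"
proof -
  have meas[measurable]: "X i \<in> borel_measurable M" for i
    using ind by (auto simp: indep_vars_def)
  have int: "integrable M (X i)" for i
    using square_integrable_imp_integrable[OF meas sq] .
  have "integrable M (\<lambda>\<omega>. (\<Sum>i<n. X i \<omega>)\<^sup>2) \<and>
      expectation (\<lambda>\<omega>. (\<Sum>i<n. X i \<omega>)\<^sup>2) = (\<Sum>i<n. expectation (\<lambda>\<omega>. (X i \<omega>)\<^sup>2))"
  proof (induction n)
    case (Suc n)
    have iv: "indep_var borel (X n) borel (\<lambda>\<omega>. \<Sum>i<n. X i \<omega>)"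
      by (intro indep_vars_sum indep_vars_subset[OF ind]) auto
    have ii: "integrable M (\<lambda>\<omega>. \<Sum>i<n. X i \<omega>)" by (intro Bochner_Integration.integrable_sum int)
    note cross = indep_var_lebesgue_integral[OF iv int ii] indep_var_integrable[OF iv int ii]
    have eq: "(\<Sum>i<Suc n. X i \<omega>)\<^sup>2 =
        (\<Sum>i<n. X i \<omega>)\<^sup>2 + (2 * (X n \<omega> * (\<Sum>i<n. X i \<omega>)) + (X n \<omega>)\<^sup>2)" for \<omega>
      by (simp add: power2_eq_square algebra_simps)
    show ?case
      unfolding eq using Suc cross sq[of n] mean[of n] by simp
  qed simp
  then show "integrable M (\<lambda>\<omega>. (\<Sum>i<n. X i \<omega>)\<^sup>2)"
    and "expectation (\<lambda>\<omega>. (\<Sum>i<n. X i \<omega>)\<^sup>2) = (\<Sum>i<n. expectation (\<lambda>\<omega>. (X i \<omega>)\<^sup>2))" by auto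
qed

end

subsection \<open>Sums of i.i.d. random variables\<close>

locale iid_sequence = prob_space M for M :: "'a measure" +
  fixes S :: "'s measure" and Z :: "nat \<Rightarrow> 'a \<Rightarrow> 's"
  assumes indep: "indep_vars (\<lambda>_. S) Z UNIV"
    and distr_eq: "distr M S (Z i) = distr M S (Z 0)"
begin

lemma measurable_draw [measurable]: "Z i \<in> measurable M S"
  using indep by (auto simp: indep_vars_def)

lemma integrable_draw_iff:
  fixes f :: "'s \<Rightarrow> real"
  assumes [measurable]: "f \<in> borel_measurable S"
  shows "integrable M (\<lambda>\<omega>. f (Z i \<omega>)) \<longleftrightarrow> integrable M (\<lambda>\<omega>. f (Z 0 \<omega>))"
  using integrable_distr_eq[of "Z i" M S f] integrable_distr_eq[of "Z 0" M S f]
  by (simp add: distr_eq[of i])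

lemma expectation_draw:
  fixes f :: "'s \<Rightarrow> real"
  assumes [measurable]: "f \<in> borel_measurable S"
  shows "expectation (\<lambda>\<omega>. f (Z i \<omega>)) = expectation (\<lambda>\<omega>. f (Z 0 \<omega>))"
  using integral_distr[of "Z i" M S f] integral_distr[of "Z 0" M S f]
  by (simp add: distr_eq[of i])

lemma AE_draw:
  assumes [measurable]: "Measurable.pred S P" and "AE \<omega> in M. P (Z 0 \<omega>)"
  shows "AE \<omega> in M. P (Z i \<omega>)"
proof -
  have "AE x in distr M S (Z 0). P x"
    using assms(2) by (subst AE_distr_iff) auto
  then have "AE x in distr M S (Z i). P x" by (subst distr_eq)
  then show ?thesis by (subst (asm) AE_distr_iff) auto
qed

lemma prob_sum_ge:
  fixes f :: "'s \<Rightarrow> real"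
  assumes [measurable]: "f \<in> borel_measurable S"
    and sq: "integrable M (\<lambda>\<omega>. (f (Z 0 \<omega>))\<^sup>2)" and mean: "expectation (\<lambda>\<omega>. f (Z 0 \<omega>)) = 0"
    and "a > 0"
  shows "prob {\<omega> \<in> space M. a \<le> \<bar>\<Sum>i<n. f (Z i \<omega>)\<bar>} \<le> real n * expectation (\<lambda>\<omega>. (f (Z 0 \<omega>))\<^sup>2) / a\<^sup>2"
proof -
  have ind: "indep_vars (\<lambda>_. borel) (\<lambda>i \<omega>. f (Z i \<omega>)) UNIV"
    by (rule indep_vars_compose2[OF indep]) simp
  have sqi: "integrable M (\<lambda>\<omega>. (f (Z i \<omega>))\<^sup>2)" for i
    using integrable_draw_iff[of "\<lambda>x. (f x)\<^sup>2" i] sq by simp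
  have mi: "expectation (\<lambda>\<omega>. f (Z i \<omega>)) = 0" for i
    using expectation_draw[of f i] mean by simp
  have sqe: "expectation (\<lambda>\<omega>. (f (Z i \<omega>))\<^sup>2) = expectation (\<lambda>\<omega>. (f (Z 0 \<omega>))\<^sup>2)" for i
    using expectation_draw[of "\<lambda>x. (f x)\<^sup>2" i] by simp
  note s = expectation_sum_square[OF ind sqi mi, of n]
  have "prob {\<omega> \<in> space M. a \<le> \<bar>\<Sum>i<n. f (Z i \<omega>)\<bar>} = prob {\<omega> \<in> space M. a\<^sup>2 \<le> (\<Sum>i<n. f (Z i \<omega>))\<^sup>2}"
    using \<open>a > 0\<close> by (simp add: abs_le_square_iff[symmetric])
  also have "\<dots> \<le> expectation (\<lambda>\<omega>. (\<Sum>i<n. f (Z i \<omega>))\<^sup>2) / a\<^sup>2"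
    using s(1) \<open>a > 0\<close> by (intro integral_Markov_inequality_measure[where A="{}"]) auto
  also have "\<dots> = (\<Sum>i<n. expectation (\<lambda>\<omega>. (f (Z 0 \<omega>))\<^sup>2)) / a\<^sup>2"
    unfolding s(2) by (intro arg_cong2[where f="(/)"] sum.cong refl sqe)
  finally show ?thesis by simp
qed

lemma Op1_normalized_sum:
  fixes f :: "'s \<Rightarrow> real"
  assumes f[measurable]: "f \<in> borel_measurable S"
    and sq: "integrable M (\<lambda>\<omega>. (f (Z 0 \<omega>))\<^sup>2)" and mean: "expectation (\<lambda>\<omega>. f (Z 0 \<omega>)) = 0"
  shows "Op1 M (\<lambda>n \<omega>. (\<Sum>i<n. f (Z i \<omega>)) / sqrt (real n))"
  unfolding Op1_def
proof (intro allI impI)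
  fix \<delta> :: real assume \<delta>: "\<delta> > 0"
  define v where "v = expectation (\<lambda>\<omega>. (f (Z 0 \<omega>))\<^sup>2)"
  have v: "v \<ge> 0" by (simp add: v_def)
  define C where "C = sqrt ((v + 1) / \<delta>)"
  have C: "C > 0" "C\<^sup>2 = (v + 1) / \<delta>" using v \<delta> by (auto simp: C_def)
  have "\<forall>\<^sub>F n in sequentially. outer_less M (\<lambda>\<omega>. C < norm ((\<Sum>i<n. f (Z i \<omega>)) / sqrt (real n))) \<delta>"
    using eventually_gt_at_top[of 0]
  proof eventually_elim
    case (elim n)
    let ?A = "{\<omega> \<in> space M. C * sqrt (real n) \<le> \<bar>\<Sum>i<n. f (Z i \<omega>)\<bar>}"
    have "prob ?A \<le> real n * v / (C * sqrt (real n))\<^sup>2"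
      unfolding v_def using C elim by (intro prob_sum_ge f sq mean) auto
    also have "\<dots> = v / (v + 1) * \<delta>"
      using elim by (simp add: power_mult_distrib C)
    also have "\<dots> < \<delta>" using v \<delta> by (simp add: field_simps)
    finally have "prob ?A < \<delta>" .
    moreover have "{\<omega> \<in> space M. C < norm ((\<Sum>i<n. f (Z i \<omega>)) / sqrt (real n))} \<subseteq> ?A"
      using elim by (auto simp: field_simps)
    ultimately show ?case
      unfolding outer_less_def by (intro bexI[of _ ?A]) auto
  qed
  then show "\<exists>C>0. \<forall>\<^sub>F n in sequentially. outer_less M (\<lambda>\<omega>. C < norm ((\<Sum>i<n. f (Z i \<omega>)) / sqrt (real n))) \<delta>"
    using C by blast
qed

lemma op1_mean_square_integrable:
  fixes f :: "'s \<Rightarrow> real"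
  assumes f[measurable]: "f \<in> borel_measurable S" and sq: "integrable M (\<lambda>\<omega>. (f (Z 0 \<omega>))\<^sup>2)"
  shows "op1 M (\<lambda>n \<omega>. (\<Sum>i<n. f (Z i \<omega>)) / real n - expectation (\<lambda>\<omega>. f (Z 0 \<omega>)))"
proof -
  let ?m = "expectation (\<lambda>\<omega>. f (Z 0 \<omega>))"
  have int: "integrable M (\<lambda>\<omega>. f (Z 0 \<omega>))"
    by (rule square_integrable_imp_integrable[OF _ sq]) simp
  have T: "Op1 M (\<lambda>n \<omega>. (\<Sum>i<n. f (Z i \<omega>) - ?m) / sqrt (real n))"
  proof (rule Op1_normalized_sum)
    show "integrable M (\<lambda>\<omega>. (f (Z 0 \<omega>) - ?m)\<^sup>2)"
      unfolding power2_diff using int sq by (intro Bochner_Integration.integrable_add Bochner_Integration.integrable_diff) auto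
    show "expectation (\<lambda>\<omega>. f (Z 0 \<omega>) - ?m) = 0" using int by (simp add: prob_space)
  qed simp
  have "op1 M (\<lambda>n \<omega>. 1 / sqrt (real n))"
  proof (rule op1I)
    fix \<epsilon> \<delta> :: real assume "\<epsilon> > 0" "\<delta> > 0"
    have "(\<lambda>n. 1 / sqrt (real n)) \<longlonglongrightarrow> 0"
      by (intro tendsto_divide_0[OF tendsto_const] filterlim_at_top_imp_at_infinity
          filterlim_compose[OF sqrt_at_top filterlim_real_sequentially])
    then have "\<forall>\<^sub>F n in sequentially. 1 / sqrt (real n) < \<epsilon>"
      using \<open>\<epsilon> > 0\<close> by (rule order_tendstoD)
    then show "\<forall>\<^sub>F n in sequentially. outer_less M (\<lambda>\<omega>. \<epsilon> < norm (1 / sqrt (real n))) \<delta>"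
      by eventually_elim (use \<open>\<delta> > 0\<close> in \<open>auto simp: outer_less_def intro!: bexI[of _ "{}"]\<close>)
  qed
  from op1_mult_Op1[OF this T] show ?thesis
  proof (rule op1_AE_mono[OF _ op1_zero zero_less_one], intro AE_I2 allI impI)
    fix \<omega> and n :: nat assume "n > 0"
    then have "1 / sqrt (real n) * ((\<Sum>i<n. f (Z i \<omega>) - ?m) / sqrt (real n)) =
        (\<Sum>i<n. f (Z i \<omega>)) / real n - ?m"
      by (simp add: sum_subtractf diff_divide_distrib)
    then show "norm ((\<Sum>i<n. f (Z i \<omega>)) / real n - ?m) \<le>
        norm (1 / sqrt (real n) * ((\<Sum>i<n. f (Z i \<omega>) - ?m) / sqrt (real n)))" by simp
  qed
qed

lemma op1_mean:
  fixes f :: "'s \<Rightarrow> real"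
  assumes f[measurable]: "f \<in> borel_measurable S" and int: "integrable M (\<lambda>\<omega>. f (Z 0 \<omega>))"
  shows "op1 M (\<lambda>n \<omega>. (\<Sum>i<n. f (Z i \<omega>)) / real n - expectation (\<lambda>\<omega>. f (Z 0 \<omega>)))"
proof (rule op1I)
  fix \<epsilon> \<delta> :: real assume pos: "\<epsilon> > 0" "\<delta> > 0"
  define h where "h c x = f x * indicat_real {x. \<bar>f x\<bar> \<le> real c} x" for c :: nat and x
  define k where "k c x = \<bar>f x - h c x\<bar>" for c :: nat and x
  have hk[measurable]: "h c \<in> borel_measurable S" "k c \<in> borel_measurable S" for c
    unfolding h_def[abs_def] k_def[abs_def] by (auto simp: indicator_def)
  have kb: "\<bar>k c x\<bar> \<le> \<bar>f x\<bar>" for c x by (auto simp: k_def h_def indicator_def)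
  have hint: "integrable M (\<lambda>\<omega>. h c (Z 0 \<omega>))" for c
    by (rule Bochner_Integration.integrable_bound[OF int]) (auto simp: h_def indicator_def)
  have kint: "integrable M (\<lambda>\<omega>. k c (Z i \<omega>))" for c i
    unfolding integrable_draw_iff[OF hk(2), of _ i]
    by (rule Bochner_Integration.integrable_bound[OF int]) (use kb in auto)
  have "(\<lambda>c. expectation (\<lambda>\<omega>. k c (Z 0 \<omega>))) \<longlonglongrightarrow> expectation (\<lambda>\<omega>. 0)"
  proof (rule integral_dominated_convergence[where w="\<lambda>\<omega>. \<bar>f (Z 0 \<omega>)\<bar>"])
    show "AE \<omega> in M. (\<lambda>c. k c (Z 0 \<omega>)) \<longlonglongrightarrow> 0"
    proof (intro AE_I2 tendsto_eventually)
      fix \<omega>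
      show "\<forall>\<^sub>F c in sequentially. k c (Z 0 \<omega>) = 0"
        using eventually_ge_at_top[of "nat \<lceil>\<bar>f (Z 0 \<omega>)\<bar>\<rceil>"]
        by eventually_elim (auto simp: k_def h_def indicator_def)
    qed
  qed (use int kb in auto)
  then have "\<forall>\<^sub>F c in sequentially. expectation (\<lambda>\<omega>. k c (Z 0 \<omega>)) < min (\<epsilon>/3) (\<epsilon>/3 * (\<delta>/2))"
    using pos by (intro order_tendstoD(2)[where y=0]) auto
  then obtain c where c: "expectation (\<lambda>\<omega>. k c (Z 0 \<omega>)) < \<epsilon>/3"
    "expectation (\<lambda>\<omega>. k c (Z 0 \<omega>)) < \<epsilon>/3 * (\<delta>/2)"
    by (auto dest: eventually_happens)
  have hsq: "integrable M (\<lambda>\<omega>. (h c (Z 0 \<omega>))\<^sup>2)"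
    by (rule integrable_const_bound[where B="(real c)\<^sup>2"])
      (auto simp: h_def indicator_def abs_le_square_iff[symmetric])
  have mdiff: "\<bar>expectation (\<lambda>\<omega>. f (Z 0 \<omega>)) - expectation (\<lambda>\<omega>. h c (Z 0 \<omega>))\<bar> < \<epsilon>/3"
  proof -
    have "\<bar>expectation (\<lambda>\<omega>. f (Z 0 \<omega>)) - expectation (\<lambda>\<omega>. h c (Z 0 \<omega>))\<bar>
        = \<bar>expectation (\<lambda>\<omega>. f (Z 0 \<omega>) - h c (Z 0 \<omega>))\<bar>" using int hint by simp
    also have "\<dots> \<le> expectation (\<lambda>\<omega>. k c (Z 0 \<omega>))"
      unfolding k_def by (rule integral_abs_bound)
    finally show ?thesis using c by simp
  qed
  have "\<forall>\<^sub>F n in sequentially. outer_less M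
      (\<lambda>\<omega>. \<epsilon>/3 < norm ((\<Sum>i<n. h c (Z i \<omega>)) / real n - expectation (\<lambda>\<omega>. h c (Z 0 \<omega>)))) (\<delta>/2)"
    using op1D[OF op1_mean_square_integrable[OF hk(1) hsq], of "\<epsilon>/3" "\<delta>/2"] pos by simp
  then show "\<forall>\<^sub>F n in sequentially. outer_less M
      (\<lambda>\<omega>. \<epsilon> < norm ((\<Sum>i<n. f (Z i \<omega>)) / real n - expectation (\<lambda>\<omega>. f (Z 0 \<omega>)))) \<delta>"
    using eventually_gt_at_top[of 0]
  proof eventually_elim
    case (elim n)
    let ?A = "{\<omega> \<in> space M. \<epsilon>/3 \<le> (\<Sum>i<n. k c (Z i \<omega>)) / real n}"
    have "prob ?A \<le> expectation (\<lambda>\<omega>. (\<Sum>i<n. k c (Z i \<omega>)) / real n) / (\<epsilon>/3)"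
      using kint pos
      by (intro integral_Markov_inequality_measure[where A="{}"])
        (auto simp: k_def intro!: divide_nonneg_nonneg sum_nonneg)
    also have "expectation (\<lambda>\<omega>. (\<Sum>i<n. k c (Z i \<omega>)) / real n)
        = (\<Sum>i<n. expectation (\<lambda>\<omega>. k c (Z i \<omega>))) / real n"
      using kint by simp
    also have "\<dots> = (\<Sum>i<n. expectation (\<lambda>\<omega>. k c (Z 0 \<omega>))) / real n"
      by (intro arg_cong2[where f="(/)"] sum.cong refl expectation_draw hk)
    also have "\<dots> = expectation (\<lambda>\<omega>. k c (Z 0 \<omega>))"
      using elim by simp
    also have "expectation (\<lambda>\<omega>. k c (Z 0 \<omega>)) / (\<epsilon>/3) < \<delta>/2"
      using c pos by (simp add: field_simps)
    finally have "outer_less M (\<lambda>\<omega>. \<epsilon>/3 \<le> (\<Sum>i<n. k c (Z i \<omega>)) / real n) (\<delta>/2)"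
      unfolding outer_less_def by (intro bexI[of _ ?A]) auto
    then show ?case
    proof (rule outer_less_disj_half[OF elim(1)], intro AE_I2 impI)
      fix \<omega> assume *: "\<epsilon> < norm ((\<Sum>i<n. f (Z i \<omega>)) / real n - expectation (\<lambda>\<omega>. f (Z 0 \<omega>)))"
      have "\<bar>(\<Sum>i<n. f (Z i \<omega>)) / real n - (\<Sum>i<n. h c (Z i \<omega>)) / real n\<bar>
          = \<bar>\<Sum>i<n. f (Z i \<omega>) - h c (Z i \<omega>)\<bar> / real n"
        by (simp add: sum_subtractf diff_divide_distrib[symmetric])
      also have "\<dots> \<le> (\<Sum>i<n. k c (Z i \<omega>)) / real n"
        unfolding k_def by (intro divide_right_mono sum_abs) simp
      finally show "\<epsilon>/3 < norm ((\<Sum>i<n. h c (Z i \<omega>)) / real n - expectation (\<lambda>\<omega>. h c (Z 0 \<omega>)))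
          \<or> \<epsilon>/3 \<le> (\<Sum>i<n. k c (Z i \<omega>)) / real n"
        using * mdiff by (simp only: real_norm_def) argo
    qed
  qed
qed

end

subsection \<open>Least squares\<close>

lemma integrable_mult_square_integrable:
  fixes f g :: "'a \<Rightarrow> real"
  assumes [measurable]: "f \<in> borel_measurable M" "g \<in> borel_measurable M"
    and "integrable M (\<lambda>x. (f x)\<^sup>2)" "integrable M (\<lambda>x. (g x)\<^sup>2)"
  shows "integrable M (\<lambda>x. f x * g x)"
proof (rule Bochner_Integration.integrable_bound)
  show "integrable M (\<lambda>x. (f x)\<^sup>2 + (g x)\<^sup>2)" using assms by simp
  have "\<bar>a * b\<bar> \<le> a\<^sup>2 + b\<^sup>2" for a b :: real
    using sum_squares_bound[of "\<bar>a\<bar>" "\<bar>b\<bar>"] mult_nonneg_nonneg[of "\<bar>a\<bar>" "\<bar>b\<bar>"]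
    by (simp add: abs_mult del: mult_nonneg_nonneg zero_le_mult_iff)
  then show "AE x in M. norm (f x * g x) \<le> norm ((f x)\<^sup>2 + (g x)\<^sup>2)" by simp
qed simp

locale square_integrable_regression =
  fixes M :: "'a measure" and R :: "'a \<Rightarrow> 'e::euclidean_space" and y :: "'a \<Rightarrow> real"
  assumes R_meas [measurable]: "R \<in> borel_measurable M"
    and y_meas [measurable]: "y \<in> borel_measurable M"
    and R_sq: "integrable M (\<lambda>x. (norm (R x))\<^sup>2)"
    and y_sq: "integrable M (\<lambda>x. (y x)\<^sup>2)"
begin

lemma inner_square_integrable: "integrable M (\<lambda>x. (R x \<bullet> v)\<^sup>2)"
proof (rule Bochner_Integration.integrable_bound)
  show "integrable M (\<lambda>x. (norm (R x))\<^sup>2 * (norm v)\<^sup>2)" using R_sq by simp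
  show "AE x in M. norm ((R x \<bullet> v)\<^sup>2) \<le> norm ((norm (R x))\<^sup>2 * (norm v)\<^sup>2)"
    using Cauchy_Schwarz_ineq[of "R _" v] by (simp add: power2_norm_eq_inner)
qed simp

lemma inner_inner_integrable: "integrable M (\<lambda>x. (R x \<bullet> u) * (R x \<bullet> v))"
  by (intro integrable_mult_square_integrable inner_square_integrable) auto

lemma response_inner_integrable: "integrable M (\<lambda>x. y x * (R x \<bullet> v))"
  by (intro integrable_mult_square_integrable inner_square_integrable y_sq) auto

lemma residual_square_integrable: "integrable M (\<lambda>x. (y x - R x \<bullet> b)\<^sup>2)"
  unfolding power2_diff
  by (intro Bochner_Integration.integrable_diff Bochner_Integration.integrable_add y_sq
      inner_square_integrable) (use response_inner_integrable[of b] in \<open>simp add: mult.assoc\<close>)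

lemma residual_inner_integrable: "integrable M (\<lambda>x. (y x - R x \<bullet> b) * (R x \<bullet> v))"
  by (intro integrable_mult_square_integrable inner_square_integrable residual_square_integrable) auto

definition null_directions :: "'e set" where
  "null_directions = {v. AE x in M. R x \<bullet> v = 0}"

lemma null_directions_iff: "v \<in> null_directions \<longleftrightarrow> integral\<^sup>L M (\<lambda>x. (R x \<bullet> v)\<^sup>2) = 0"
  using integral_nonneg_eq_0_iff_AE[OF inner_square_integrable[of v]]
  by (simp add: null_directions_def)

lemma subspace_null_directions: "subspace null_directions"
  unfolding subspace_def null_directions_def
proof (intro conjI ballI allI)
  fix u v assume "u \<in> {v. AE x in M. R x \<bullet> v = 0}" "v \<in> {v. AE x in M. R x \<bullet> v = 0}"
  then have "AE x in M. R x \<bullet> u = 0" "AE x in M. R x \<bullet> v = 0" by auto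
  then have "AE x in M. R x \<bullet> (u + v) = 0" by eventually_elim (simp add: inner_add_right)
  then show "u + v \<in> {v. AE x in M. R x \<bullet> v = 0}" by simp
qed auto

definition gram :: "'e \<Rightarrow> 'e" where
  "gram u = (\<Sum>i\<in>Basis. integral\<^sup>L M (\<lambda>x. (R x \<bullet> u) * (R x \<bullet> i)) *\<^sub>R i)"

lemma linear_gram: "linear gram"
proof (rule linearI)
  show "gram (u + v) = gram u + gram v" for u v
    by (simp add: gram_def inner_add_right distrib_right inner_inner_integrable scaleR_add_left
        sum.distrib)
  show "gram (c *\<^sub>R u) = c *\<^sub>R gram u" for c u
    by (simp add: gram_def scaleR_sum_right mult.assoc)
qed

lemma integral_mult_inner:
  assumes "\<And>v. integrable M (\<lambda>x. f x * (R x \<bullet> v))"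
  shows "integral\<^sup>L M (\<lambda>x. f x * (R x \<bullet> v))
    = (\<Sum>i\<in>Basis. integral\<^sup>L M (\<lambda>x. f x * (R x \<bullet> i)) *\<^sub>R i) \<bullet> v"
proof -
  have eq: "f x * (R x \<bullet> v) = (\<Sum>i\<in>Basis. (f x * (R x \<bullet> i)) * (i \<bullet> v))" for x
    by (subst euclidean_inner[of "R x" v])
      (simp add: sum_distrib_left mult.assoc inner_commute)
  show ?thesis
    unfolding eq using assms by (simp add: inner_sum_left)
qed

lemma gram_inner: "gram u \<bullet> v = integral\<^sup>L M (\<lambda>x. (R x \<bullet> u) * (R x \<bullet> v))"
  unfolding gram_def by (rule integral_mult_inner[symmetric]) (rule inner_inner_integrable)

text \<open>The part of the moment vector of \<open>y\<close> orthogonal to the range of \<open>gram\<close> is a null direction,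
  hence orthogonal to that moment vector itself, hence zero.\<close>
lemma normal_equations_solvable:
  "\<exists>b. \<forall>v. integral\<^sup>L M (\<lambda>x. (y x - R x \<bullet> b) * (R x \<bullet> v)) = 0"
proof -
  define l where "l = (\<Sum>i\<in>Basis. integral\<^sup>L M (\<lambda>x. y x * (R x \<bullet> i)) *\<^sub>R i)"
  have l: "l \<bullet> v = integral\<^sup>L M (\<lambda>x. y x * (R x \<bullet> v))" for v
    unfolding l_def by (rule integral_mult_inner[symmetric]) (rule response_inner_integrable)
  obtain p q where p: "p \<in> span (range gram)" and q: "\<And>w. w \<in> span (range gram) \<Longrightarrow> orthogonal q w"
    and lpq: "l = p + q"
    by (rule orthogonal_subspace_decomp_exists[of "range gram" l]) blast
  have "gram q \<bullet> q = 0"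
    using q[OF span_base[of "gram q"]] by (simp add: orthogonal_def inner_commute)
  then have "q \<in> null_directions"
    by (simp add: gram_inner null_directions_iff power2_eq_square)
  then have "AE x in M. y x * (R x \<bullet> q) = 0"
    unfolding null_directions_def by auto
  then have "integral\<^sup>L M (\<lambda>x. y x * (R x \<bullet> q)) = integral\<^sup>L M (\<lambda>x. 0)"
    by (intro integral_cong_AE) auto
  then have "l \<bullet> q = 0"
    by (simp add: l)
  moreover have "p \<bullet> q = 0" using q[OF p] by (simp add: orthogonal_def inner_commute)
  ultimately have "q = 0" by (simp add: lpq inner_add_left)
  moreover have "span (range gram) = range gram"
    by (simp add: span_eq_iff linear_gram linear_subspace_image)
  ultimately obtain b where b: "l = gram b" using p lpq by (metis add.right_neutral imageE)
  have "integral\<^sup>L M (\<lambda>x. (y x - R x \<bullet> b) * (R x \<bullet> v)) = l \<bullet> v - gram b \<bullet> v" for v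
    by (simp add: l gram_inner left_diff_distrib response_inner_integrable inner_inner_integrable)
  then show ?thesis using b by auto
qed

lemma residual_square_decomp:
  assumes "\<And>v. integral\<^sup>L M (\<lambda>x. (y x - R x \<bullet> b) * (R x \<bullet> v)) = 0"
  shows "integral\<^sup>L M (\<lambda>x. (y x - R x \<bullet> b')\<^sup>2)
    = integral\<^sup>L M (\<lambda>x. (y x - R x \<bullet> b)\<^sup>2) + integral\<^sup>L M (\<lambda>x. (R x \<bullet> (b' - b))\<^sup>2)"
proof -
  have eq: "(y x - R x \<bullet> b')\<^sup>2 =
     (y x - R x \<bullet> b)\<^sup>2 - 2 * ((y x - R x \<bullet> b) * (R x \<bullet> (b' - b))) + (R x \<bullet> (b' - b))\<^sup>2" for x
    by (simp add: inner_diff_right power2_eq_square algebra_simps)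
  show ?thesis
    unfolding eq using assms[of "b' - b"]
    by (simp add: residual_square_integrable inner_square_integrable residual_inner_integrable)
qed

lemma least_squares_exists:
  "\<exists>b. \<forall>b'. integral\<^sup>L M (\<lambda>x. (y x - R x \<bullet> b)\<^sup>2) \<le> integral\<^sup>L M (\<lambda>x. (y x - R x \<bullet> b')\<^sup>2)"
proof -
  obtain b where "\<And>v. integral\<^sup>L M (\<lambda>x. (y x - R x \<bullet> b) * (R x \<bullet> v)) = 0"
    using normal_equations_solvable by blast
  then have "integral\<^sup>L M (\<lambda>x. (y x - R x \<bullet> b)\<^sup>2) \<le> integral\<^sup>L M (\<lambda>x. (y x - R x \<bullet> b')\<^sup>2)" for b'
    by (subst (2) residual_square_decomp) auto
  then show ?thesis by blast
qed

lemma least_squares_normal_equations: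
  assumes "\<And>b'. integral\<^sup>L M (\<lambda>x. (y x - R x \<bullet> b)\<^sup>2) \<le> integral\<^sup>L M (\<lambda>x. (y x - R x \<bullet> b')\<^sup>2)"
  shows "integral\<^sup>L M (\<lambda>x. (y x - R x \<bullet> b) * (R x \<bullet> v)) = 0"
proof -
  obtain b0 where b0: "\<And>v. integral\<^sup>L M (\<lambda>x. (y x - R x \<bullet> b0) * (R x \<bullet> v)) = 0"
    using normal_equations_solvable by blast
  have "integral\<^sup>L M (\<lambda>x. (R x \<bullet> (b - b0))\<^sup>2) = 0"
    using residual_square_decomp[OF b0, of b] assms[of b0]
    by (intro antisym integral_nonneg_AE) auto
  then have "AE x in M. R x \<bullet> (b - b0) = 0"
    unfolding null_directions_iff[symmetric] by (simp add: null_directions_def)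
  then have "integral\<^sup>L M (\<lambda>x. (y x - R x \<bullet> b) * (R x \<bullet> v))
      = integral\<^sup>L M (\<lambda>x. (y x - R x \<bullet> b0) * (R x \<bullet> v))"
    by (intro integral_cong_AE) (auto simp: inner_diff_right)
  then show ?thesis using b0 by simp
qed

lemma gram_coercive:
  obtains c where "c > 0"
    and "\<And>v. (\<And>w. w \<in> null_directions \<Longrightarrow> v \<bullet> w = 0) \<Longrightarrow>
           c * (norm v)\<^sup>2 \<le> integral\<^sup>L M (\<lambda>x. (R x \<bullet> v)\<^sup>2)"
proof -
  define Q where "Q v = gram v \<bullet> v" for v
  have Q: "Q v = integral\<^sup>L M (\<lambda>x. (R x \<bullet> v)\<^sup>2)" for v
    by (simp add: Q_def gram_inner power2_eq_square)
  define T where "T = sphere 0 1 \<inter> (\<Inter>w\<in>null_directions. {v. v \<bullet> w = 0})"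
  have "compact T"
    unfolding T_def
    by (intro compact_Int_closed closed_INT ballI compact_sphere)
      (simp add: inner_commute[of _ "_ :: 'e"] closed_hyperplane)
  have cont: "continuous_on T Q"
    unfolding Q_def
    by (intro continuous_intros linear_continuous_on) (simp add: linear_gram linear_conv_bounded_linear[symmetric])
  obtain c where c: "c > 0" "\<And>v. v \<in> T \<Longrightarrow> c \<le> Q v"
  proof (cases "T = {}")
    case True then show ?thesis using that[of 1] by auto
  next
    case False
    then obtain v where v: "v \<in> T" "\<And>u. u \<in> T \<Longrightarrow> Q v \<le> Q u"
      using continuous_attains_inf[OF \<open>compact T\<close> _ cont] by auto
    have "Q v \<noteq> 0"
    proof
      assume "Q v = 0"
      then have "v \<in> null_directions" by (simp add: null_directions_iff Q)
      then have "v \<bullet> v = 0" using v(1) by (auto simp: T_def)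
      then show False using v(1) by (simp add: T_def)
    qed
    moreover have "Q v \<ge> 0" by (simp add: Q)
    ultimately show ?thesis using that[of "Q v"] v by auto
  qed
  show thesis
  proof (rule that[OF c(1)])
    fix v assume v: "\<And>w. w \<in> null_directions \<Longrightarrow> v \<bullet> w = 0"
    show "c * (norm v)\<^sup>2 \<le> integral\<^sup>L M (\<lambda>x. (R x \<bullet> v)\<^sup>2)"
    proof (cases "v = 0")
      case False
      then have "sgn v \<in> T" using v by (auto simp: T_def sgn_div_norm)
      then have "c \<le> Q (sgn v)" by (rule c)
      also have "Q (sgn v) = Q v / (norm v)\<^sup>2"
        by (simp add: Q_def sgn_div_norm linear_scale[OF linear_gram] power2_eq_square field_simps)
      finally show ?thesis using False by (simp add: Q field_simps)
    qed simp
  qed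
qed

end

context iid_sequence
begin

lemma least_squares_consistent:
  fixes R :: "'s \<Rightarrow> 'e::euclidean_space" and y :: "'s \<Rightarrow> real"
  assumes R[measurable]: "R \<in> borel_measurable S" and y[measurable]: "y \<in> borel_measurable S"
    and "square_integrable_regression M (\<lambda>\<omega>. R (Z 0 \<omega>)) (\<lambda>\<omega>. y (Z 0 \<omega>))"
    and normal: "\<And>v. expectation (\<lambda>\<omega>. (y (Z 0 \<omega>) - R (Z 0 \<omega>) \<bullet> \<theta>0) * (R (Z 0 \<omega>) \<bullet> v)) = 0"
  obtains D r :: "nat \<Rightarrow> 'a \<Rightarrow> real" where "op1 M D" "op1 M r"
    "AE \<omega> in M. \<forall>n \<theta>. n > 0 \<longrightarrow>
       (\<forall>v. (\<Sum>i<n. (y (Z i \<omega>) - R (Z i \<omega>) \<bullet> \<theta>) * (R (Z i \<omega>) \<bullet> v)) = 0) \<longrightarrow> \<bar>D n \<omega>\<bar> < 1 \<longrightarrow>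
       (\<exists>d. norm d \<le> r n \<omega> \<and> (\<forall>i. R (Z i \<omega>) \<bullet> (\<theta> - \<theta>0 - d) = 0) \<and>
            (AE \<omega>' in M. R (Z 0 \<omega>') \<bullet> (\<theta> - \<theta>0 - d) = 0))"
proof -
  interpret Q: square_integrable_regression M "\<lambda>\<omega>. R (Z 0 \<omega>)" "\<lambda>\<omega>. y (Z 0 \<omega>)" by fact
  let ?K = "Q.null_directions"
  obtain c where c: "c > 0" and coer: "\<And>v. (\<And>w. w \<in> ?K \<Longrightarrow> v \<bullet> w = 0) \<Longrightarrow>
           c * (norm v)\<^sup>2 \<le> expectation (\<lambda>\<omega>. (R (Z 0 \<omega>) \<bullet> v)\<^sup>2)"
    by (rule Q.gram_coercive) blast
  define e where "e x = y x - R x \<bullet> \<theta>0" for x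
  have e_meas[measurable]: "e \<in> borel_measurable S" unfolding e_def[abs_def] by measurable
  define E where "E a b n \<omega> = (\<Sum>i<n. (R (Z i \<omega>) \<bullet> a) * (R (Z i \<omega>) \<bullet> b)) / real n
      - expectation (\<lambda>\<omega>. (R (Z 0 \<omega>) \<bullet> a) * (R (Z 0 \<omega>) \<bullet> b))" for a b n \<omega>
  define h where "h a n \<omega> = (\<Sum>i<n. e (Z i \<omega>) * (R (Z i \<omega>) \<bullet> a)) / real n" for a n \<omega>
  have E: "op1 M (E a b)" for a b
    unfolding E_def by (rule op1_mean) (simp_all add: Q.inner_inner_integrable)
  have h: "op1 M (h a)" for a
  proof -
    have "op1 M (\<lambda>n \<omega>. h a n \<omega> - expectation (\<lambda>\<omega>. e (Z 0 \<omega>) * (R (Z 0 \<omega>) \<bullet> a)))"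
      unfolding h_def by (rule op1_mean) (simp_all add: e_def Q.residual_inner_integrable)
    then show ?thesis using normal by (simp add: e_def)
  qed
  define D where "D n \<omega> = 2/c * (\<Sum>a\<in>Basis. \<Sum>b\<in>Basis. \<bar>E a b n \<omega>\<bar>)" for n \<omega>
  define r where "r n \<omega> = 2/c * (\<Sum>a\<in>Basis. \<bar>h a n \<omega>\<bar>)" for n \<omega>
  have "op1 M D" unfolding D_def by (intro op1_cmult op1_sum op1_abs E)
  moreover have "op1 M r" unfolding r_def by (intro op1_cmult op1_sum op1_abs h)
  moreover have "AE \<omega> in M. \<forall>i. \<forall>z\<in>?K. R (Z i \<omega>) \<bullet> z = 0"
  proof -
    obtain B where B: "B \<subseteq> ?K" "independent B" "?K \<subseteq> span B" 
      using basis_exists[of ?K] by metis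
    have "AE \<omega> in M. \<forall>i. \<forall>z\<in>B. R (Z i \<omega>) \<bullet> z = 0"
    proof (subst AE_all_countable, rule)
      fix i
      have "AE \<omega> in M. R (Z i \<omega>) \<bullet> z = 0" if "z \<in> B" for z
      proof -
        have "AE \<omega> in M. R (Z 0 \<omega>) \<bullet> z = 0"
          using that B(1) unfolding Q.null_directions_def by blast
        then show ?thesis
          by (rule AE_draw[where P="\<lambda>x. R x \<bullet> z = 0", rotated]) measurable
      qed
      then show "AE \<omega> in M. \<forall>z\<in>B. R (Z i \<omega>) \<bullet> z = 0"
        using independent_imp_finite[OF B(2)] by (simp add: AE_finite_all)
    qed
    then show ?thesis
    proof eventually_elim
      case (elim \<omega>)
      have "span B \<subseteq> {z. R (Z i \<omega>) \<bullet> z = 0}" for i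
        using elim by (intro span_minimal subspace_hyperplane) auto
      then show ?case using B(3) by blast
    qed
  qed
  then have "AE \<omega> in M. \<forall>n \<theta>. n > 0 \<longrightarrow>
       (\<forall>v. (\<Sum>i<n. (y (Z i \<omega>) - R (Z i \<omega>) \<bullet> \<theta>) * (R (Z i \<omega>) \<bullet> v)) = 0) \<longrightarrow> \<bar>D n \<omega>\<bar> < 1 \<longrightarrow>
       (\<exists>d. norm d \<le> r n \<omega> \<and> (\<forall>i. R (Z i \<omega>) \<bullet> (\<theta> - \<theta>0 - d) = 0) \<and>
            (AE \<omega>' in M. R (Z 0 \<omega>') \<bullet> (\<theta> - \<theta>0 - d) = 0))"
  proof eventually_elim
    case (elim \<omega>)
    show ?case
    proof (intro allI impI)
      fix n \<theta> assume n: "n > 0" and D1: "\<bar>D n \<omega>\<bar> < 1"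
        and ne: "\<forall>v. (\<Sum>i<n. (y (Z i \<omega>) - R (Z i \<omega>) \<bullet> \<theta>) * (R (Z i \<omega>) \<bullet> v)) = 0"
      obtain z d where zd: "z \<in> span ?K" "\<And>w. w \<in> span ?K \<Longrightarrow> orthogonal d w" "\<theta> - \<theta>0 = z + d"
        by (rule orthogonal_subspace_decomp_exists[of ?K "\<theta> - \<theta>0"]) blast
      have z: "z \<in> ?K" using zd(1) Q.subspace_null_directions span_eq_iff by blast
      have d: "d \<bullet> w = 0" if "w \<in> ?K" for w
        using zd(2)[OF span_base[OF that]] by (simp add: orthogonal_def)
      have Rz: "R (Z i \<omega>) \<bullet> z = 0" for i using elim z by blast
      have th: "R (Z i \<omega>) \<bullet> \<theta> = R (Z i \<omega>) \<bullet> \<theta>0 + R (Z i \<omega>) \<bullet> d" for i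
        using Rz[of i] arg_cong[OF zd(3), of "\<lambda>v. R (Z i \<omega>) \<bullet> v"]
        by (simp add: inner_diff_right inner_add_right)
      have coord: "x \<bullet> d = (\<Sum>a\<in>Basis. (d \<bullet> a) * (x \<bullet> a))" for x
        by (subst euclidean_inner) (simp add: mult.commute)
      have sq: "(x \<bullet> d)\<^sup>2 = (\<Sum>a\<in>Basis. \<Sum>b\<in>Basis. ((d \<bullet> a) * (d \<bullet> b)) * ((x \<bullet> a) * (x \<bullet> b)))" for x
        unfolding coord power2_eq_square sum_product by (simp add: mult_ac)
      have "(\<Sum>i<n. (R (Z i \<omega>) \<bullet> d)\<^sup>2) = (\<Sum>i<n. e (Z i \<omega>) * (R (Z i \<omega>) \<bullet> d))"
        using ne[rule_format, of d]
        by (simp add: e_def th power2_eq_square algebra_simps sum.distrib sum_subtractf)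
      also have "\<dots> = (\<Sum>a\<in>Basis. (d \<bullet> a) * (\<Sum>i<n. e (Z i \<omega>) * (R (Z i \<omega>) \<bullet> a)))"
        unfolding coord sum_distrib_left by (subst sum.swap) (simp add: mult_ac)
      finally have lhs: "(\<Sum>i<n. (R (Z i \<omega>) \<bullet> d)\<^sup>2) / real n = (\<Sum>a\<in>Basis. (d \<bullet> a) * h a n \<omega>)"
        by (simp add: h_def sum_divide_distrib[of _ "Basis :: 'e set"])
      have "(\<Sum>a\<in>Basis. (d \<bullet> a) * h a n \<omega>) \<le> (\<Sum>a\<in>Basis. norm d * \<bar>h a n \<omega>\<bar>)"
      proof (rule sum_mono)
        fix a :: 'e assume "a \<in> Basis"
        have "(d \<bullet> a) * h a n \<omega> \<le> \<bar>d \<bullet> a\<bar> * \<bar>h a n \<omega>\<bar>" by (metis abs_ge_self abs_mult)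
        also have "\<dots> \<le> norm d * \<bar>h a n \<omega>\<bar>"
          using Basis_le_norm[OF \<open>a \<in> Basis\<close>] by (intro mult_right_mono) auto
        finally show "(d \<bullet> a) * h a n \<omega> \<le> norm d * \<bar>h a n \<omega>\<bar>" .
      qed
      also have "\<dots> = norm d * (c/2 * r n \<omega>)"
        using c by (simp add: r_def sum_distrib_left)
      finally have up: "(\<Sum>i<n. (R (Z i \<omega>) \<bullet> d)\<^sup>2) / real n \<le> norm d * (c/2 * r n \<omega>)"
        by (simp add: lhs)
      have "(\<Sum>i<n. (R (Z i \<omega>) \<bullet> d)\<^sup>2) / real n - expectation (\<lambda>\<omega>. (R (Z 0 \<omega>) \<bullet> d)\<^sup>2)
          = (\<Sum>a\<in>Basis. \<Sum>b\<in>Basis. ((d \<bullet> a) * (d \<bullet> b)) * E a b n \<omega>)"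
      proof -
        have "(\<Sum>i<n. (R (Z i \<omega>) \<bullet> d)\<^sup>2) = (\<Sum>a\<in>Basis. \<Sum>b\<in>Basis. ((d \<bullet> a) * (d \<bullet> b)) *
            (\<Sum>i<n. (R (Z i \<omega>) \<bullet> a) * (R (Z i \<omega>) \<bullet> b)))"
          unfolding sq sum_distrib_left
          by (subst sum.swap) (intro sum.cong refl sum.swap)
        moreover have "expectation (\<lambda>\<omega>. (R (Z 0 \<omega>) \<bullet> d)\<^sup>2) = (\<Sum>a\<in>Basis. \<Sum>b\<in>Basis. ((d \<bullet> a) * (d \<bullet> b)) *
            expectation (\<lambda>\<omega>. (R (Z 0 \<omega>) \<bullet> a) * (R (Z 0 \<omega>) \<bullet> b)))"
          unfolding sq
          by (simp add: Q.inner_inner_integrable)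
        ultimately show ?thesis
          by (simp add: E_def sum_divide_distrib[of _ "Basis :: 'e set"] right_diff_distrib sum_subtractf)
      qed
      also have "\<dots> \<ge> - (\<Sum>a\<in>Basis. \<Sum>b\<in>Basis. (norm d)\<^sup>2 * \<bar>E a b n \<omega>\<bar>)"
        unfolding sum_negf[symmetric]
      proof (intro sum_mono)
        fix a b :: 'e assume ab: "a \<in> Basis" "b \<in> Basis"
        have "\<bar>((d \<bullet> a) * (d \<bullet> b)) * E a b n \<omega>\<bar> \<le> (norm d)\<^sup>2 * \<bar>E a b n \<omega>\<bar>"
          unfolding abs_mult power2_eq_square
          using ab by (intro mult_mono Basis_le_norm) auto
        then show "- ((norm d)\<^sup>2 * \<bar>E a b n \<omega>\<bar>) \<le> ((d \<bullet> a) * (d \<bullet> b)) * E a b n \<omega>" by linarith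
      qed
      also have "(\<Sum>a\<in>Basis. \<Sum>b\<in>Basis. (norm d)\<^sup>2 * \<bar>E a b n \<omega>\<bar>) = (norm d)\<^sup>2 * (c/2 * D n \<omega>)"
        using c by (simp add: D_def sum_distrib_left)
      finally have "expectation (\<lambda>\<omega>. (R (Z 0 \<omega>) \<bullet> d)\<^sup>2) - (norm d)\<^sup>2 * (c/2 * D n \<omega>)
          \<le> (\<Sum>i<n. (R (Z i \<omega>) \<bullet> d)\<^sup>2) / real n" by linarith
      moreover have "(norm d)\<^sup>2 * (c/2 * D n \<omega>) \<le> (norm d)\<^sup>2 * (c/2)"
        using D1 c by (intro mult_left_mono) auto
      ultimately have "c * (norm d)\<^sup>2 - (norm d)\<^sup>2 * (c/2) \<le> norm d * (c/2 * r n \<omega>)"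
        using coer[OF d] up by linarith
      then have "norm d * norm d * (c/2) \<le> norm d * r n \<omega> * (c/2)"
        by (simp add: power2_eq_square algebra_simps)
      then have "norm d * norm d \<le> norm d * r n \<omega>"
        by (rule mult_right_le_imp_le) (use c in simp)
      moreover have "r n \<omega> \<ge> 0" using c by (auto simp: r_def intro!: mult_nonneg_nonneg sum_nonneg)
      ultimately have "norm d \<le> r n \<omega>" by (cases "d = 0") auto
      moreover have "\<theta> - \<theta>0 - d = z" using zd(3) by simp
      ultimately show "\<exists>d. norm d \<le> r n \<omega> \<and> (\<forall>i. R (Z i \<omega>) \<bullet> (\<theta> - \<theta>0 - d) = 0) \<and>
            (AE \<omega>' in M. R (Z 0 \<omega>') \<bullet> (\<theta> - \<theta>0 - d) = 0)"
        using Rz z by (intro exI[of _ d]) (auto simp: Q.null_directions_def)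
    qed
  qed
  ultimately show thesis by (rule that)
qed

end

subsection \<open>Randomized experiments\<close>

lemma borel_measurable_vec_nth_comp [measurable (raw)]:
  fixes f :: "'a \<Rightarrow> real^'n"
  assumes "f \<in> borel_measurable M"
  shows "(\<lambda>x. f x $ i) \<in> borel_measurable M"
  by (rule measurable_compose[OF assms])
    (intro borel_measurable_continuous_onI continuous_intros)

lemma inner_le_norm_sum_components:
  fixes x d :: "real^'n"
  assumes "norm d \<le> r"
  shows "\<bar>x \<bullet> d\<bar> \<le> r * (\<Sum>k\<in>UNIV. \<bar>x $ k\<bar>)"
proof -
  have "\<bar>x \<bullet> d\<bar> \<le> norm x * norm d" by (rule Cauchy_Schwarz_ineq2)
  also have "\<dots> \<le> (\<Sum>k\<in>UNIV. \<bar>x $ k\<bar>) * r"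
    using assms by (intro mult_mono norm_le_l1_cart) (auto intro: sum_nonneg)
  finally show ?thesis by (simp add: mult.commute)
qed

lemma ols_normal_equations:
  fixes Z :: "nat \<Rightarrow> 'a \<Rightarrow> ('g::finite, 'k::finite) draw"
  obtains b where "\<And>a v. (\<Sum>i<n. (Yobs Z i \<omega> - Wv Z i \<omega> \<bullet> ols_mu Z n \<omega> - Xddot Z n i \<omega> \<bullet> b)
                         * (Wv Z i \<omega> \<bullet> a + Xddot Z n i \<omega> \<bullet> v)) = 0"
proof -
  interpret square_integrable_regression "count_space {..<n}"
    "\<lambda>i. (Wv Z i \<omega>, Xddot Z n i \<omega>)" "\<lambda>i. Yobs Z i \<omega>"
    by unfold_locales (auto intro: integrable_count_space)
  have ssr: "(\<integral>i. (Yobs Z i \<omega> - (Wv Z i \<omega>, Xddot Z n i \<omega>) \<bullet> mb)\<^sup>2 \<partial>count_space {..<n})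
      = SSR Z n \<omega> (fst mb) (snd mb)" for mb
    by (cases mb) (simp add: SSR_def lebesgue_integral_count_space_finite diff_diff_eq)
  define mb where "mb = (SOME mb. \<forall>m' b'. SSR Z n \<omega> (fst mb) (snd mb) \<le> SSR Z n \<omega> m' b')"
  have "\<exists>mb. \<forall>m' b'. SSR Z n \<omega> (fst mb) (snd mb) \<le> SSR Z n \<omega> m' b'"
    using least_squares_exists unfolding ssr by (metis fst_conv snd_conv)
  from someI_ex[OF this] have min: "\<forall>m' b'. SSR Z n \<omega> (fst mb) (snd mb) \<le> SSR Z n \<omega> m' b'"
    unfolding mb_def .
  have "(\<integral>i. (Yobs Z i \<omega> - (Wv Z i \<omega>, Xddot Z n i \<omega>) \<bullet> mb) * ((Wv Z i \<omega>, Xddot Z n i \<omega>) \<bullet> (a, v))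
      \<partial>count_space {..<n}) = 0" for a v
    by (rule least_squares_normal_equations) (use min in \<open>simp only: ssr\<close>)
  moreover have "mb = (ols_mu Z n \<omega>, snd mb)" by (simp add: ols_mu_def mb_def)
  ultimately have "(\<Sum>i<n. (Yobs Z i \<omega> - (Wv Z i \<omega>, Xddot Z n i \<omega>) \<bullet> (ols_mu Z n \<omega>, snd mb))
      * ((Wv Z i \<omega>, Xddot Z n i \<omega>) \<bullet> (a, v))) = 0" for a v
    by (simp add: lebesgue_integral_count_space_finite)
  then show thesis
    by (intro that[of "snd mb"]) (simp add: diff_diff_eq)
qed

locale randomized_experiment = iid_sequence M borel Z
  for M :: "'a measure" and Z :: "nat \<Rightarrow> 'a \<Rightarrow> ('g::finite, 'k::finite) draw" +
  assumes W_01: "\<omega> \<in> space M \<Longrightarrow> Wv Z i \<omega> $ g = 0 \<or> Wv Z i \<omega> $ g = 1"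
    and W_sum: "\<omega> \<in> space M \<Longrightarrow> (\<Sum>g\<in>UNIV. Wv Z i \<omega> $ g) = 1"
    and rho_pos: "rho M Z g > 0"
    and randomized: "indep_set {Wv Z 0 -` A \<inter> space M | A. A \<in> sets borel}
           {(\<lambda>\<omega>. (Yv Z 0 \<omega>, Xv Z 0 \<omega>)) -` B \<inter> space M | B. B \<in> sets borel}"
    and Y_sq: "integrable M (\<lambda>\<omega>. (Yv Z 0 \<omega> $ g)\<^sup>2)"
    and X_sq: "integrable M (\<lambda>\<omega>. (norm (Xv Z 0 \<omega>))\<^sup>2)"
begin

abbreviation \<mu> :: "real^'g" where "\<mu> \<equiv> muY M Z"
abbreviation \<beta> :: "real^'k" where "\<beta> \<equiv> betaobs M Z"
abbreviation \<rho> :: "'g \<Rightarrow> real" where "\<rho> \<equiv> rho M Z"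
abbreviation W :: "nat \<Rightarrow> 'a \<Rightarrow> real^'g" where "W \<equiv> Wv Z"
abbreviation Xd :: "nat \<Rightarrow> 'a \<Rightarrow> real^'k" where "Xd \<equiv> Xdot M Z"

definition resid :: "nat \<Rightarrow> 'a \<Rightarrow> real" where
  "resid i \<omega> = Yobs Z i \<omega> - W i \<omega> \<bullet> \<mu> - Xd i \<omega> \<bullet> \<beta>"

definition regressor :: "('g, 'k) draw \<Rightarrow> (real^'g) \<times> (real^'k)" where
  "regressor z = (fst z, snd (snd z) - muX M Z)"

definition response :: "('g, 'k) draw \<Rightarrow> real" where
  "response z = fst z \<bullet> fst (snd z)"

lemma regressor_draw: "regressor (Z i \<omega>) = (W i \<omega>, Xd i \<omega>)"
  by (simp add: regressor_def Wv_def Xdot_def Xv_def)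

lemma response_draw: "response (Z i \<omega>) = Yobs Z i \<omega>"
  by (simp add: response_def Yobs_def Wv_def Yv_def inner_vec_def)

lemma regressor_measurable [measurable]: "regressor \<in> borel_measurable borel"
  unfolding regressor_def[abs_def] by (intro borel_measurable_continuous_onI continuous_intros)

lemma response_measurable [measurable]: "response \<in> borel_measurable borel"
  unfolding response_def[abs_def] by (intro borel_measurable_continuous_onI continuous_intros)

lemma W_measurable [measurable]: "W i \<in> borel_measurable M"
proof -
  have "(\<lambda>\<omega>. fst (Z i \<omega>)) \<in> borel_measurable M"
    by (rule measurable_compose[OF measurable_draw])
      (intro borel_measurable_continuous_onI continuous_intros)
  then show ?thesis by (simp add: Wv_def[abs_def])
qed

lemma YX_measurable [measurable]: "(\<lambda>\<omega>. (Yv Z i \<omega>, Xv Z i \<omega>)) \<in> borel_measurable M"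
proof -
  have "(\<lambda>\<omega>. snd (Z i \<omega>)) \<in> borel_measurable M"
    by (rule measurable_compose[OF measurable_draw])
      (intro borel_measurable_continuous_onI continuous_intros)
  then show ?thesis by (simp add: Yv_def Xv_def)
qed

lemma Y_measurable [measurable]: "Yv Z i \<in> borel_measurable M"
  using measurable_compose[OF YX_measurable, of fst borel i]
  by (simp add: borel_measurable_continuous_onI continuous_on_fst[OF continuous_on_id])

lemma X_measurable [measurable]: "Xv Z i \<in> borel_measurable M"
  using measurable_compose[OF YX_measurable, of snd borel i]
  by (simp add: borel_measurable_continuous_onI continuous_on_snd[OF continuous_on_id])

lemma Xd_measurable [measurable]: "Xd i \<in> borel_measurable M"
  unfolding Xdot_def[abs_def] by measurable

lemma Yobs_eq_inner: "Yobs Z i \<omega> = W i \<omega> \<bullet> Yv Z i \<omega>"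
  by (simp add: Yobs_def inner_vec_def)

lemma Yobs_measurable [measurable]: "Yobs Z i \<in> borel_measurable M"
  unfolding Yobs_eq_inner[abs_def] by measurable

lemma W_le_1: "\<omega> \<in> space M \<Longrightarrow> \<bar>W i \<omega> $ g\<bar> \<le> 1"
  using W_01[of \<omega> i g] by auto

lemma W_one_hot:
  assumes "\<omega> \<in> space M" "g \<noteq> h"
  shows "W i \<omega> $ g * W i \<omega> $ h = 0"
proof (rule ccontr)
  assume "W i \<omega> $ g * W i \<omega> $ h \<noteq> 0"
  then have 1: "W i \<omega> $ g = 1" "W i \<omega> $ h = 1"
    using W_01[OF assms(1), of i g] W_01[OF assms(1), of i h] by auto
  have "(\<Sum>j\<in>{g, h}. W i \<omega> $ j) \<le> (\<Sum>j\<in>UNIV. W i \<omega> $ j)"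
    using W_01[OF assms(1), of i] by (intro sum_mono2) (auto, metis order_refl zero_le_one)
  then show False using 1 assms W_sum[OF assms(1), of i] by simp
qed

lemma W_mult_inner:
  assumes "\<omega> \<in> space M"
  shows "W i \<omega> $ g * (W i \<omega> \<bullet> m) = W i \<omega> $ g * m $ g"
proof -
  have "W i \<omega> $ g * (W i \<omega> \<bullet> m) = (\<Sum>h\<in>UNIV. (W i \<omega> $ g * W i \<omega> $ h) * m $ h)"
    by (simp add: inner_vec_def sum_distrib_left mult.assoc)
  also have "\<dots> = (\<Sum>h\<in>UNIV. if h = g then W i \<omega> $ g * m $ g else 0)"
    using W_one_hot[OF assms, of g _ i] W_01[OF assms, of i g] by (intro sum.cong) auto
  finally show ?thesis by simp
qed

lemma norm_W:
  assumes "\<omega> \<in> space M" shows "norm (W i \<omega>) = 1"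
proof -
  have "W i \<omega> \<bullet> W i \<omega> = (\<Sum>g\<in>UNIV. W i \<omega> $ g)"
    unfolding inner_vec_def using W_01[OF assms, of i] by (intro sum.cong) auto
  then show ?thesis by (simp add: norm_eq_sqrt_inner W_sum[OF assms])
qed

lemma Xd_sq: "integrable M (\<lambda>\<omega>. (norm (Xd 0 \<omega>))\<^sup>2)"
proof (rule Bochner_Integration.integrable_bound)
  show "integrable M (\<lambda>\<omega>. 2 * (norm (Xv Z 0 \<omega>))\<^sup>2 + 2 * (norm (muX M Z))\<^sup>2)"
    using X_sq by simp
  have "(norm (a - b))\<^sup>2 \<le> 2 * (norm a)\<^sup>2 + 2 * (norm b)\<^sup>2" for a b :: "real^'k"
  proof -
    have "(norm (a - b))\<^sup>2 \<le> (norm a + norm b)\<^sup>2"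
      by (intro power_mono norm_triangle_ineq4) auto
    also have "\<dots> \<le> 2 * (norm a)\<^sup>2 + 2 * (norm b)\<^sup>2"
      using sum_squares_bound[of "norm a" "norm b"] by (simp add: power2_sum)
    finally show ?thesis .
  qed
  then show "AE \<omega> in M. norm ((norm (Xd 0 \<omega>))\<^sup>2)
      \<le> norm (2 * (norm (Xv Z 0 \<omega>))\<^sup>2 + 2 * (norm (muX M Z))\<^sup>2)"
    by (simp add: Xdot_def)
qed simp

lemma Yobs_sq: "integrable M (\<lambda>\<omega>. (Yobs Z 0 \<omega>)\<^sup>2)"
proof (rule Bochner_Integration.integrable_bound)
  show "integrable M (\<lambda>\<omega>. \<Sum>g\<in>UNIV. (Yv Z 0 \<omega> $ g)\<^sup>2)" using Y_sq by simp
  show "AE \<omega> in M. norm ((Yobs Z 0 \<omega>)\<^sup>2) \<le> norm (\<Sum>g\<in>UNIV. (Yv Z 0 \<omega> $ g)\<^sup>2)"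
  proof (intro AE_I2)
    fix \<omega> assume \<omega>: "\<omega> \<in> space M"
    have "(Yobs Z 0 \<omega>)\<^sup>2 \<le> (W 0 \<omega> \<bullet> W 0 \<omega>) * (Yv Z 0 \<omega> \<bullet> Yv Z 0 \<omega>)"
      unfolding Yobs_eq_inner by (rule Cauchy_Schwarz_ineq)
    also have "W 0 \<omega> \<bullet> W 0 \<omega> = 1" by (simp add: norm_W[OF \<omega>] dot_square_norm)
    finally show "norm ((Yobs Z 0 \<omega>)\<^sup>2) \<le> norm (\<Sum>g\<in>UNIV. (Yv Z 0 \<omega> $ g)\<^sup>2)"
      by (simp add: inner_vec_def power2_eq_square sum_nonneg)
  qed
qed simp

sublocale long: square_integrable_regression M "\<lambda>\<omega>. regressor (Z 0 \<omega>)" "\<lambda>\<omega>. response (Z 0 \<omega>)"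
proof
  have "integrable M (\<lambda>\<omega>. 1 + (norm (Xd 0 \<omega>))\<^sup>2)" using Xd_sq by simp
  also have "?this \<longleftrightarrow> integrable M (\<lambda>\<omega>. (norm (regressor (Z 0 \<omega>)))\<^sup>2)"
    by (intro Bochner_Integration.integrable_cong refl) (simp add: regressor_draw norm_Pair norm_W)
  finally show "integrable M (\<lambda>\<omega>. (norm (regressor (Z 0 \<omega>)))\<^sup>2)" .
  show "integrable M (\<lambda>\<omega>. (response (Z 0 \<omega>))\<^sup>2)" by (simp add: response_draw Yobs_sq)
qed auto

sublocale short: square_integrable_regression M "Xd 0" "Yobs Z 0"
  by unfold_locales (auto simp: Xd_sq Yobs_sq)

lemma betaobs_normal_equations:
  "expectation (\<lambda>\<omega>. (Yobs Z 0 \<omega> - Xd 0 \<omega> \<bullet> \<beta>) * (Xd 0 \<omega> \<bullet> v)) = 0"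
  by (rule short.least_squares_normal_equations)
    (use someI_ex[OF short.least_squares_exists] in \<open>simp add: betaobs_def\<close>)

lemma indep_W:
  fixes \<psi> :: "(real^'g) \<times> (real^'k) \<Rightarrow> real"
  assumes [measurable]: "\<psi> \<in> borel_measurable borel"
  shows "indep_var borel (\<lambda>\<omega>. W 0 \<omega> $ g) borel (\<lambda>\<omega>. \<psi> (Yv Z 0 \<omega>, Xv Z 0 \<omega>))"
  unfolding indep_var_def indep_vars_def2
proof
  let ?X = "case_bool (\<lambda>\<omega>. W 0 \<omega> $ g) (\<lambda>\<omega>. \<psi> (Yv Z 0 \<omega>, Xv Z 0 \<omega>))"
  show "\<forall>i\<in>UNIV. random_variable (case_bool borel borel i) (?X i)"
    by (auto split: bool.split)
  show "indep_sets (\<lambda>i. {?X i -` A \<inter> space M |A. A \<in> sets (case_bool borel borel i)}) UNIV"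
  proof (rule indep_sets_mono_sets[OF randomized[unfolded indep_set_def]])
    fix i :: bool
    have "\<exists>B. (\<lambda>\<omega>. W 0 \<omega> $ g) -` A \<inter> space M = W 0 -` B \<inter> space M \<and> B \<in> sets borel"
      if "A \<in> sets borel" for A :: "real set"
      using measurable_sets[OF borel_measurable_vec_nth_comp[OF measurable_ident] that, of g]
      by (intro exI[of _ "(\<lambda>w. w $ g) -` A"]) (auto simp: vimage_def)
    moreover have "\<exists>B. (\<lambda>\<omega>. \<psi> (Yv Z 0 \<omega>, Xv Z 0 \<omega>)) -` A \<inter> space M
        = (\<lambda>\<omega>. (Yv Z 0 \<omega>, Xv Z 0 \<omega>)) -` B \<inter> space M \<and> B \<in> sets borel"
      if "A \<in> sets borel" for A :: "real set"
      using measurable_sets[OF assms that]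
      by (intro exI[of _ "\<psi> -` A"]) (auto simp: vimage_def)
    ultimately show "{?X i -` A \<inter> space M |A. A \<in> sets (case_bool borel borel i)} \<subseteq>
      case_bool {W 0 -` A \<inter> space M | A. A \<in> sets borel}
        {(\<lambda>\<omega>. (Yv Z 0 \<omega>, Xv Z 0 \<omega>)) -` B \<inter> space M | B. B \<in> sets borel} i"
      by (cases i) auto
  qed
qed

lemma expectation_W: "expectation (\<lambda>\<omega>. W 0 \<omega> $ g) = \<rho> g"
proof -
  have "expectation (\<lambda>\<omega>. W 0 \<omega> $ g) = expectation (indicator {\<omega> \<in> space M. W 0 \<omega> $ g = 1})"
    using W_01[of _ 0 g] by (intro Bochner_Integration.integral_cong) (auto simp: indicator_def)
  then show ?thesis by (simp add: rho_def)
qed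

lemma W_integrable: "integrable M (\<lambda>\<omega>. W i \<omega> $ g)"
  using W_le_1 by (intro integrable_const_bound[where B=1]) auto

lemma expectation_W_mult:
  fixes \<psi> :: "(real^'g) \<times> (real^'k) \<Rightarrow> real"
  assumes "\<psi> \<in> borel_measurable borel" "integrable M (\<lambda>\<omega>. \<psi> (Yv Z 0 \<omega>, Xv Z 0 \<omega>))"
  shows "expectation (\<lambda>\<omega>. W 0 \<omega> $ g * \<psi> (Yv Z 0 \<omega>, Xv Z 0 \<omega>))
    = \<rho> g * expectation (\<lambda>\<omega>. \<psi> (Yv Z 0 \<omega>, Xv Z 0 \<omega>))"
  using indep_var_lebesgue_integral[OF indep_W[OF assms(1)] W_integrable assms(2)]
  by (simp add: expectation_W)

lemma Xd_inner_integrable: "integrable M (\<lambda>\<omega>. Xd 0 \<omega> \<bullet> v)"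
  by (rule square_integrable_imp_integrable[OF _ short.inner_square_integrable]) simp

lemma X_integrable: "integrable M (Xv Z 0)"
proof -
  have "integrable M (\<lambda>\<omega>. norm (Xv Z 0 \<omega>))"
    by (rule square_integrable_imp_integrable[OF _ X_sq]) simp
  then show ?thesis by (rule integrable_norm_cancel) simp
qed

lemma expectation_Xd_inner: "expectation (\<lambda>\<omega>. Xd 0 \<omega> \<bullet> v) = 0"
  using X_integrable by (simp add: Xdot_def muX_def prob_space inner_diff_left)

lemma Y_integrable: "integrable M (\<lambda>\<omega>. Yv Z 0 \<omega> $ g)"
  by (rule square_integrable_imp_integrable[OF _ Y_sq]) simp

lemma expectation_W_Xd_inner: "expectation (\<lambda>\<omega>. W 0 \<omega> $ g * (Xd 0 \<omega> \<bullet> v)) = 0"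
proof -
  have "(\<lambda>p. (snd p - muX M Z) \<bullet> v) \<in> borel_measurable (borel :: ((real^'g) \<times> (real^'k)) measure)"
    by (intro borel_measurable_continuous_onI continuous_intros)
  from expectation_W_mult[OF this, of g] show ?thesis
    using Xd_inner_integrable[of v] expectation_Xd_inner[of v] by (simp add: Xdot_def)
qed

lemma W_mult_resid:
  assumes "\<omega> \<in> space M"
  shows "W i \<omega> $ g * resid i \<omega> = W i \<omega> $ g * (Yv Z i \<omega> $ g - \<mu> $ g - Xd i \<omega> \<bullet> \<beta>)"
  by (simp only: resid_def Yobs_eq_inner right_diff_distrib W_mult_inner[OF assms])

lemma expectation_W_resid: "expectation (\<lambda>\<omega>. W 0 \<omega> $ g * resid 0 \<omega>) = 0"
proof -
  let ?\<psi> = "\<lambda>p. fst p $ g - \<mu> $ g - (snd p - muX M Z) \<bullet> \<beta>"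
  have m: "?\<psi> \<in> borel_measurable borel"
    by (intro borel_measurable_continuous_onI continuous_intros)
  have i: "integrable M (\<lambda>\<omega>. ?\<psi> (Yv Z 0 \<omega>, Xv Z 0 \<omega>))"
    using Y_integrable Xd_inner_integrable[of \<beta>] by (simp add: Xdot_def)
  have "expectation (\<lambda>\<omega>. ?\<psi> (Yv Z 0 \<omega>, Xv Z 0 \<omega>)) = 0"
    using Y_integrable Xd_inner_integrable[of \<beta>] expectation_Xd_inner[of \<beta>]
    by (simp add: Xdot_def muY_def prob_space)
  then have "expectation (\<lambda>\<omega>. W 0 \<omega> $ g * ?\<psi> (Yv Z 0 \<omega>, Xv Z 0 \<omega>)) = 0"
    using expectation_W_mult[OF m i, of g] by simp
  also have "expectation (\<lambda>\<omega>. W 0 \<omega> $ g * ?\<psi> (Yv Z 0 \<omega>, Xv Z 0 \<omega>))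
      = expectation (\<lambda>\<omega>. W 0 \<omega> $ g * resid 0 \<omega>)"
    by (intro Bochner_Integration.integral_cong refl) (simp add: W_mult_resid Xdot_def)
  finally show ?thesis .
qed

lemma resid_draw: "resid i \<omega> = response (Z i \<omega>) - regressor (Z i \<omega>) \<bullet> (\<mu>, \<beta>)"
  by (simp add: resid_def response_draw regressor_draw)

lemma resid_measurable [measurable]: "resid i \<in> borel_measurable M"
  unfolding resid_def[abs_def] by measurable

lemma resid_sq: "integrable M (\<lambda>\<omega>. (resid 0 \<omega>)\<^sup>2)"
  unfolding resid_draw by (rule long.residual_square_integrable)

lemma W_mult_sq:
  assumes "f \<in> borel_measurable M" "integrable M (\<lambda>\<omega>. (f \<omega>)\<^sup>2)"
  shows "integrable M (\<lambda>\<omega>. (W 0 \<omega> $ g * f \<omega>)\<^sup>2)"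
proof (rule Bochner_Integration.integrable_bound[OF assms(2)])
  show "AE \<omega> in M. norm ((W 0 \<omega> $ g * f \<omega>)\<^sup>2) \<le> norm ((f \<omega>)\<^sup>2)"
    using W_01[of _ 0 g] by (intro AE_I2) (auto, metis mult_1 mult_zero_left order_refl zero_le_power2 power_zero_numeral)
qed (use assms in simp)

lemma resid_normal_equations:
  "expectation (\<lambda>\<omega>. (response (Z 0 \<omega>) - regressor (Z 0 \<omega>) \<bullet> (\<mu>, \<beta>)) * (regressor (Z 0 \<omega>) \<bullet> v)) = 0"
proof -
  obtain a u where v: "v = (a, u)" by (cases v)
  have Wr: "integrable M (\<lambda>\<omega>. W 0 \<omega> $ g * resid 0 \<omega>)" for g
    by (rule square_integrable_imp_integrable[OF _ W_mult_sq[OF _ resid_sq]]) auto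
  have WX: "integrable M (\<lambda>\<omega>. W 0 \<omega> $ g * (Xd 0 \<omega> \<bullet> u))" for g
    by (rule square_integrable_imp_integrable[OF _ W_mult_sq[OF _ short.inner_square_integrable]]) auto
  have "(response (Z 0 \<omega>) - regressor (Z 0 \<omega>) \<bullet> (\<mu>, \<beta>)) * (regressor (Z 0 \<omega>) \<bullet> v)
      = (\<Sum>g\<in>UNIV. a $ g * (W 0 \<omega> $ g * resid 0 \<omega>))
        + ((Yobs Z 0 \<omega> - Xd 0 \<omega> \<bullet> \<beta>) * (Xd 0 \<omega> \<bullet> u)
        - (\<Sum>g\<in>UNIV. \<mu> $ g * (W 0 \<omega> $ g * (Xd 0 \<omega> \<bullet> u))))" for \<omega>
  proof -
    have "(\<Sum>g\<in>UNIV. a $ g * (W 0 \<omega> $ g * resid 0 \<omega>)) = (W 0 \<omega> \<bullet> a) * resid 0 \<omega>"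
      by (simp add: inner_vec_def sum_distrib_left mult_ac)
    moreover have "(\<Sum>g\<in>UNIV. \<mu> $ g * (W 0 \<omega> $ g * (Xd 0 \<omega> \<bullet> u))) = (W 0 \<omega> \<bullet> \<mu>) * (Xd 0 \<omega> \<bullet> u)"
      by (simp add: inner_vec_def[of "W 0 \<omega>"] sum_distrib_left mult_ac)
    ultimately show ?thesis
      by (simp add: v resid_draw[symmetric] regressor_draw) (simp add: resid_def response_draw algebra_simps)
  qed
  then show ?thesis
    using betaobs_normal_equations[of u]
    by (simp add: Wr WX expectation_W_resid expectation_W_Xd_inner short.residual_inner_integrable)
qed

lemma null_direction_fst:
  assumes "AE \<omega> in M. regressor (Z 0 \<omega>) \<bullet> z = 0"
  shows "fst z = 0"
proof -
  have "fst z $ g = 0" for g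
  proof -
    have WX: "integrable M (\<lambda>\<omega>. W 0 \<omega> $ g * (Xd 0 \<omega> \<bullet> snd z))"
      by (rule square_integrable_imp_integrable[OF _ W_mult_sq[OF _ short.inner_square_integrable]]) auto
    have "expectation (\<lambda>\<omega>. W 0 \<omega> $ g * fst z $ g + W 0 \<omega> $ g * (Xd 0 \<omega> \<bullet> snd z))
        = expectation (\<lambda>\<omega>. 0)"
    proof (rule integral_cong_AE)
      show "AE \<omega> in M. W 0 \<omega> $ g * fst z $ g + W 0 \<omega> $ g * (Xd 0 \<omega> \<bullet> snd z) = 0"
        using assms AE_space
      proof eventually_elim
        case (elim \<omega>)
        then have "W 0 \<omega> $ g * (W 0 \<omega> \<bullet> fst z + Xd 0 \<omega> \<bullet> snd z) = 0"
          by (simp add: regressor_draw inner_prod_def)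
        then show ?case using W_mult_inner[OF elim(2)] by (simp add: distrib_left)
      qed
    qed auto
    then have "\<rho> g * fst z $ g = 0"
      using WX W_integrable[of 0 g] by (simp add: expectation_W expectation_W_Xd_inner)
    then show ?thesis using rho_pos[of g] by simp
  qed
  then show ?thesis by (simp add: vec_eq_iff)
qed

lemma recentred_normal_equations:
  assumes "\<omega> \<in> space M" "n > 0"
  obtains m b where
    "\<And>g. ols_mu Z n \<omega> $ g = m $ g + (\<Sum>i<n. Xd i \<omega> \<bullet> b) / real n"
    "\<And>v. (\<Sum>i<n. (response (Z i \<omega>) - regressor (Z i \<omega>) \<bullet> (m, b)) * (regressor (Z i \<omega>) \<bullet> v)) = 0"
proof -
  obtain b where b: "\<And>a v. (\<Sum>i<n. (Yobs Z i \<omega> - W i \<omega> \<bullet> ols_mu Z n \<omega> - Xddot Z n i \<omega> \<bullet> b)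
                         * (W i \<omega> \<bullet> a + Xddot Z n i \<omega> \<bullet> v)) = 0"
    by (rule ols_normal_equations[where Z=Z and n=n and \<omega>=\<omega>]) blast
  define xb where "xb = (1 / real n) *\<^sub>R (\<Sum>i<n. Xd i \<omega>)"
  define j :: "real^'g" where "j = (\<chi> g. 1)"
  have Wj: "W i \<omega> \<bullet> j = 1" for i
    using W_sum[OF assms(1), of i] by (simp add: j_def inner_vec_def)
  have xb: "xb \<bullet> v = (\<Sum>i<n. Xd i \<omega> \<bullet> v) / real n" for v
    by (simp add: xb_def inner_sum_left)
  have Xdd: "Xddot Z n i \<omega> = Xd i \<omega> - xb" for i
    using assms(2) by (simp add: Xddot_def Xdot_def xb_def sum_subtractf scaleR_diff_right
        sum_constant_scaleR del: sum_constant)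
  define m where "m = ols_mu Z n \<omega> - (xb \<bullet> b) *\<^sub>R j"
  show thesis
  proof (rule that[of m b])
    show "ols_mu Z n \<omega> $ g = m $ g + (\<Sum>i<n. Xd i \<omega> \<bullet> b) / real n" for g
      by (simp add: m_def xb j_def)
    show "(\<Sum>i<n. (response (Z i \<omega>) - regressor (Z i \<omega>) \<bullet> (m, b)) * (regressor (Z i \<omega>) \<bullet> v)) = 0" for v
    proof -
      have "(response (Z i \<omega>) - regressor (Z i \<omega>) \<bullet> (m, b)) * (regressor (Z i \<omega>) \<bullet> v)
        = (Yobs Z i \<omega> - W i \<omega> \<bullet> ols_mu Z n \<omega> - Xddot Z n i \<omega> \<bullet> b)
          * (W i \<omega> \<bullet> (fst v + (xb \<bullet> snd v) *\<^sub>R j) + Xddot Z n i \<omega> \<bullet> snd v)" for i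
        by (cases v) (simp add: response_draw regressor_draw Xdd m_def Wj inner_diff_right inner_diff_left inner_add_right)
      then show ?thesis using b by simp
    qed
  qed
qed

lemma influence_eq:
  assumes "\<omega> \<in> space M"
  shows "(Fv M Z i \<omega> + Kv M Z i \<omega> + Qv M Z i \<omega>) $ g = W i \<omega> $ g * resid i \<omega> / \<rho> g + Xd i \<omega> \<bullet> \<beta>"
  unfolding W_mult_resid[OF assms] using rho_pos[of g]
  by (simp add: Fv_def Kv_def Qv_def Uerr_def inner_diff_right field_simps)

lemma ols_asymptotically_linear:
  "op1 M (\<lambda>N \<omega>. sqrt (real N) *\<^sub>R (ols_mu Z N \<omega> - \<mu>)
     - (1 / sqrt (real N)) *\<^sub>R (\<Sum>i<N. Fv M Z i \<omega> + Kv M Z i \<omega> + Qv M Z i \<omega>))"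
  (is "op1 M ?V")
proof -
  obtain D r :: "nat \<Rightarrow> 'a \<Rightarrow> real" where D: "op1 M D" and r: "op1 M r" and cons: "AE \<omega> in M. \<forall>n \<theta>. n > 0 \<longrightarrow>
       (\<forall>v. (\<Sum>i<n. (response (Z i \<omega>) - regressor (Z i \<omega>) \<bullet> \<theta>) * (regressor (Z i \<omega>) \<bullet> v)) = 0) \<longrightarrow>
       \<bar>D n \<omega>\<bar> < 1 \<longrightarrow>
       (\<exists>d. norm d \<le> r n \<omega> \<and> (\<forall>i. regressor (Z i \<omega>) \<bullet> (\<theta> - (\<mu>, \<beta>) - d) = 0) \<and>
            (AE \<omega>' in M. regressor (Z 0 \<omega>') \<bullet> (\<theta> - (\<mu>, \<beta>) - d) = 0))"
    by (rule least_squares_consistent[OF regressor_measurable response_measurable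
          long.square_integrable_regression_axioms resid_normal_equations])
  define p where "p g n \<omega> = (\<Sum>i<n. W i \<omega> $ g) / real n" for g n \<omega>
  define T where "T g n \<omega> = (\<Sum>i<n. W i \<omega> $ g * resid i \<omega>) / sqrt (real n)" for g n \<omega>
  define A where "A k n \<omega> = (\<Sum>i<n. Xd i \<omega> $ k) / sqrt (real n)" for k n \<omega>
  define B where "B g k n \<omega> = (\<Sum>i<n. W i \<omega> $ g * Xd i \<omega> $ k) / sqrt (real n)" for g k n \<omega>
  have Wdraw: "W i \<omega> $ g = fst (regressor (Z i \<omega>)) $ g" for i \<omega> g by (simp add: regressor_draw)
  have Xdraw: "Xd i \<omega> $ k = snd (regressor (Z i \<omega>)) $ k" for i \<omega> k by (simp add: regressor_draw)
  have fst_m[measurable]: "(\<lambda>z. fst (regressor z)) \<in> borel_measurable borel"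
    unfolding regressor_def by (intro borel_measurable_continuous_onI continuous_intros)
  have snd_m[measurable]: "(\<lambda>z. snd (regressor z)) \<in> borel_measurable borel"
    unfolding regressor_def by (intro borel_measurable_continuous_onI continuous_intros)
  have Xk: "Xd i \<omega> $ k = Xd i \<omega> \<bullet> axis k 1" for i \<omega> k by (simp add: inner_axis)
  have p: "op1 M (\<lambda>n \<omega>. p g n \<omega> - \<rho> g)" for g
    using op1_mean[of "\<lambda>z. fst (regressor z) $ g"] W_integrable[of 0 g] expectation_W[of g]
    by (simp add: p_def Wdraw)
  have T: "Op1 M (T g)" for g
    using Op1_normalized_sum[of "\<lambda>z. fst (regressor z) $ g * (response z - regressor z \<bullet> (\<mu>, \<beta>))"]
      W_mult_sq[OF resid_measurable resid_sq, of g] expectation_W_resid[of g]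
    by (simp add: T_def[abs_def] Wdraw resid_draw)
  have A: "Op1 M (A k)" for k
    using Op1_normalized_sum[of "\<lambda>z. snd (regressor z) $ k"]
      short.inner_square_integrable[of "axis k 1"] expectation_Xd_inner[of "axis k 1"]
    by (simp add: A_def[abs_def] Xk[symmetric] Xdraw)
  have B: "Op1 M (B g k)" for g k
    using Op1_normalized_sum[of "\<lambda>z. fst (regressor z) $ g * snd (regressor z) $ k"]
      W_mult_sq[OF _ short.inner_square_integrable[of "axis k 1"], of g]
      expectation_W_Xd_inner[of g "axis k 1"]
    by (simp add: B_def[abs_def] Xk[symmetric] Wdraw Xdraw)
  define V' where "V' n \<omega> = (\<Sum>g\<in>UNIV. 2 / (\<rho> g)\<^sup>2 * (\<bar>p g n \<omega> - \<rho> g\<bar> * \<bar>T g n \<omega>\<bar>)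
      + r n \<omega> * ((\<Sum>k\<in>UNIV. \<bar>A k n \<omega>\<bar>) + 2 / \<rho> g * (\<Sum>k\<in>UNIV. \<bar>B g k n \<omega>\<bar>)))" for n \<omega>
  define D' where "D' n \<omega> = \<bar>D n \<omega>\<bar> + (\<Sum>g\<in>UNIV. 2 / \<rho> g * \<bar>p g n \<omega> - \<rho> g\<bar>)" for n \<omega>
  have "op1 M V'"
    unfolding V'_def by (intro op1_sum op1_add op1_cmult op1_mult_Op1 op1_abs Op1_add Op1_cmult
        Op1_sum Op1_abs p T r A B)
  moreover have "op1 M D'"
    unfolding D'_def by (intro op1_add op1_sum op1_cmult op1_abs p D)
  ultimately show ?thesis
  proof (rule op1_AE_mono[OF _ _ zero_less_one])
    show "AE \<omega> in M. \<forall>n>0. norm (D' n \<omega>) < 1 \<longrightarrow> norm (?V n \<omega>) \<le> norm (V' n \<omega>)"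
      using cons AE_space
    proof eventually_elim
      case (elim \<omega>)
      note \<omega> = elim(2)
      show ?case
      proof (intro allI impI)
        fix n :: nat assume n: "n > 0" and D'1: "norm (D' n \<omega>) < 1"
        define s where "s = sqrt (real n)"
        have s: "s > 0" "s * s = real n" using n by (auto simp: s_def)
        have nn: "(\<Sum>h\<in>UNIV. 2 / \<rho> h * \<bar>p h n \<omega> - \<rho> h\<bar>) \<ge> 0"
          using rho_pos by (intro sum_nonneg mult_nonneg_nonneg divide_nonneg_nonneg) (auto simp: less_imp_le)
        then have D1: "\<bar>D n \<omega>\<bar> < 1" using D'1 by (simp add: D'_def)
        have pg: "\<bar>p g n \<omega> - \<rho> g\<bar> < \<rho> g / 2" for g
        proof -
          have "2 / \<rho> g * \<bar>p g n \<omega> - \<rho> g\<bar> \<le> (\<Sum>h\<in>UNIV. 2 / \<rho> h * \<bar>p h n \<omega> - \<rho> h\<bar>)"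
            using rho_pos by (intro member_le_sum) (auto simp: less_imp_le)
          also have "\<dots> < 1" using D'1 nn by (simp add: D'_def)
          finally show ?thesis using rho_pos[of g] by (simp add: field_simps)
        qed
        obtain m b where mb: "\<And>g. ols_mu Z n \<omega> $ g = m $ g + (\<Sum>i<n. Xd i \<omega> \<bullet> b) / real n"
          and ne: "\<And>v. (\<Sum>i<n. (response (Z i \<omega>) - regressor (Z i \<omega>) \<bullet> (m, b)) * (regressor (Z i \<omega>) \<bullet> v)) = 0"
          by (rule recentred_normal_equations[OF \<omega> n]) blast
        obtain d where d: "norm d \<le> r n \<omega>"
          and dz: "\<And>i. regressor (Z i \<omega>) \<bullet> ((m, b) - (\<mu>, \<beta>) - d) = 0"
          and dAE: "AE \<omega>' in M. regressor (Z 0 \<omega>') \<bullet> ((m, b) - (\<mu>, \<beta>) - d) = 0"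
          using elim(1) n ne D1 by blast
        have d2: "norm (snd d) \<le> r n \<omega>" using d norm_snd_le[of "snd d" "fst d"] by simp
        have r0: "r n \<omega> \<ge> 0" using d norm_ge_zero order_trans by blast
        have Xb: "Xd i \<omega> \<bullet> b = Xd i \<omega> \<bullet> \<beta> + Xd i \<omega> \<bullet> snd d" for i
        proof -
          have "fst d = m - \<mu>" using null_direction_fst[OF dAE] by simp
          then show ?thesis
            using dz[of i] by (simp add: regressor_draw inner_prod_def inner_diff_right)
        qed
        have comp: "\<bar>?V n \<omega> $ g\<bar> \<le> 2 / (\<rho> g)\<^sup>2 * (\<bar>p g n \<omega> - \<rho> g\<bar> * \<bar>T g n \<omega>\<bar>)
            + r n \<omega> * ((\<Sum>k\<in>UNIV. \<bar>A k n \<omega>\<bar>) + 2 / \<rho> g * (\<Sum>k\<in>UNIV. \<bar>B g k n \<omega>\<bar>))" for g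
        proof -
          define P where "P = (\<Sum>i<n. Xd i \<omega> \<bullet> snd d) / s"
          define G where "G = (\<Sum>i<n. W i \<omega> $ g * (Xd i \<omega> \<bullet> snd d)) / s"
          have rho: "\<rho> g > 0" by (rule rho_pos)
          have pp: "p g n \<omega> > \<rho> g / 2" using pg[of g] by linarith
          then have p0: "p g n \<omega> > 0" using rho by linarith
          have "0 = (\<Sum>i<n. (response (Z i \<omega>) - regressor (Z i \<omega>) \<bullet> (m, b)) * (regressor (Z i \<omega>) \<bullet> (axis g 1, 0)))"
            using ne by simp
          also have "\<dots> = (\<Sum>i<n. W i \<omega> $ g * resid i \<omega> - W i \<omega> $ g * (m $ g - \<mu> $ g)
              - W i \<omega> $ g * (Xd i \<omega> \<bullet> snd d))"
          proof (rule sum.cong)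
            fix i
            have "(response (Z i \<omega>) - regressor (Z i \<omega>) \<bullet> (m, b)) * (regressor (Z i \<omega>) \<bullet> (axis g 1, 0))
              = W i \<omega> $ g * resid i \<omega> - (W i \<omega> $ g * (W i \<omega> \<bullet> m) - W i \<omega> $ g * (W i \<omega> \<bullet> \<mu>))
              - W i \<omega> $ g * (Xd i \<omega> \<bullet> snd d)"
              by (simp add: regressor_draw response_draw resid_def inner_axis Xb algebra_simps)
            then show "(response (Z i \<omega>) - regressor (Z i \<omega>) \<bullet> (m, b)) * (regressor (Z i \<omega>) \<bullet> (axis g 1, 0))
              = W i \<omega> $ g * resid i \<omega> - W i \<omega> $ g * (m $ g - \<mu> $ g) - W i \<omega> $ g * (Xd i \<omega> \<bullet> snd d)"
              by (simp only: W_mult_inner[OF \<omega>] right_diff_distrib)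
          qed simp
          also have "\<dots> = s * T g n \<omega> - real n * p g n \<omega> * (m $ g - \<mu> $ g) - s * G"
            using s(1) n by (simp add: T_def G_def p_def sum_subtractf sum_distrib_right s_def[symmetric])
          finally have "s * (p g n \<omega> * (s * (m $ g - \<mu> $ g))) = s * (T g n \<omega> - G)"
            by (simp add: s(2)[symmetric] algebra_simps)
          then have "p g n \<omega> * (s * (m $ g - \<mu> $ g)) = T g n \<omega> - G"
            using s(1) by (simp only: mult_cancel_left) simp
          then have mg: "s * (m $ g - \<mu> $ g) = (T g n \<omega> - G) / p g n \<omega>"
            using p0 by (simp add: eq_divide_eq mult.commute)
          have "?V n \<omega> $ g = s * (m $ g - \<mu> $ g) + s * ((\<Sum>i<n. Xd i \<omega> \<bullet> b) / real n)
              - (\<Sum>i<n. (Fv M Z i \<omega> + Kv M Z i \<omega> + Qv M Z i \<omega>) $ g) / s"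
            by (simp add: mb s_def algebra_simps)
          also have "s * ((\<Sum>i<n. Xd i \<omega> \<bullet> b) / real n) = (\<Sum>i<n. Xd i \<omega> \<bullet> \<beta>) / s + P"
            unfolding s(2)[symmetric] using s(1) by (simp add: Xb P_def sum.distrib add_divide_distrib distrib_left)
          also have "(\<Sum>i<n. (Fv M Z i \<omega> + Kv M Z i \<omega> + Qv M Z i \<omega>) $ g) / s
              = T g n \<omega> / \<rho> g + (\<Sum>i<n. Xd i \<omega> \<bullet> \<beta>) / s"
            by (simp only: influence_eq[OF \<omega>] sum.distrib add_divide_distrib T_def s_def[symmetric])
              (simp add: sum_divide_distrib[symmetric])
          finally have V: "?V n \<omega> $ g = (1 / p g n \<omega> - 1 / \<rho> g) * T g n \<omega> + (P - G / p g n \<omega>)"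
            by (simp add: mg diff_divide_distrib left_diff_distrib)
          have inv: "1 / p g n \<omega> \<le> 2 / \<rho> g" using pp p0 rho by (simp add: field_simps)
          have "\<bar>1 / p g n \<omega> - 1 / \<rho> g\<bar> = \<bar>p g n \<omega> - \<rho> g\<bar> * (1 / p g n \<omega>) * (1 / \<rho> g)"
            using p0 rho by (simp add: divide_simps abs_minus_commute)
          also have "\<dots> \<le> \<bar>p g n \<omega> - \<rho> g\<bar> * (2 / \<rho> g) * (1 / \<rho> g)"
            using inv rho by (intro mult_right_mono mult_left_mono) auto
          finally have "\<bar>1 / p g n \<omega> - 1 / \<rho> g\<bar> \<le> 2 / (\<rho> g)\<^sup>2 * \<bar>p g n \<omega> - \<rho> g\<bar>"
            by (simp add: power2_eq_square mult.commute)
          then have 1: "\<bar>(1 / p g n \<omega> - 1 / \<rho> g) * T g n \<omega>\<bar> \<le> 2 / (\<rho> g)\<^sup>2 * (\<bar>p g n \<omega> - \<rho> g\<bar> * \<bar>T g n \<omega>\<bar>)"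
            unfolding abs_mult mult.assoc[symmetric] by (rule mult_right_mono) simp
          have "P = ((1 / s) *\<^sub>R (\<Sum>i<n. Xd i \<omega>)) \<bullet> snd d" by (simp add: P_def inner_sum_left)
          then have 2: "\<bar>P\<bar> \<le> r n \<omega> * (\<Sum>k\<in>UNIV. \<bar>A k n \<omega>\<bar>)"
            using inner_le_norm_sum_components[OF d2, of "(1 / s) *\<^sub>R (\<Sum>i<n. Xd i \<omega>)"]
            by (simp add: A_def s_def)
          have "G = ((1 / s) *\<^sub>R (\<Sum>i<n. W i \<omega> $ g *\<^sub>R Xd i \<omega>)) \<bullet> snd d" by (simp add: G_def inner_sum_left)
          then have G: "\<bar>G\<bar> \<le> r n \<omega> * (\<Sum>k\<in>UNIV. \<bar>B g k n \<omega>\<bar>)"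
            using inner_le_norm_sum_components[OF d2, of "(1 / s) *\<^sub>R (\<Sum>i<n. W i \<omega> $ g *\<^sub>R Xd i \<omega>)"]
            by (simp add: B_def s_def)
          have "\<bar>G / p g n \<omega>\<bar> = \<bar>G\<bar> * (1 / p g n \<omega>)" using p0 by (simp add: abs_divide)
          also have "\<dots> \<le> (r n \<omega> * (\<Sum>k\<in>UNIV. \<bar>B g k n \<omega>\<bar>)) * (2 / \<rho> g)"
            using G inv p0 r0 by (intro mult_mono) (auto intro!: mult_nonneg_nonneg sum_nonneg)
          finally have 3: "\<bar>G / p g n \<omega>\<bar> \<le> r n \<omega> * (2 / \<rho> g * (\<Sum>k\<in>UNIV. \<bar>B g k n \<omega>\<bar>))"
            by (simp add: mult_ac)
          show ?thesis
            unfolding V distrib_left using 1 2 3 by linarith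
        qed
        have "norm (?V n \<omega>) \<le> (\<Sum>g\<in>UNIV. \<bar>?V n \<omega> $ g\<bar>)" by (rule norm_le_l1_cart)
        also have "\<dots> \<le> V' n \<omega>" unfolding V'_def by (intro sum_mono comp)
        finally show "norm (?V n \<omega>) \<le> norm (V' n \<omega>)" by simp
      qed
    qed
  qed
qed

end

theorem theorem3:
  fixes M :: "'a measure"
    and Z :: "nat \<Rightarrow> 'a \<Rightarrow> ('g::finite, 'k::finite) draw"
  assumes "prob_space M"
    and "CARD('g) \<ge> 2"
    and "\<And>i. Z i \<in> borel_measurable M"
    and "prob_space.indep_vars M (\<lambda>_. borel) Z UNIV"
    and "\<And>i. distr M borel (Z i) = distr M borel (Z 0)"
    and "\<And>i g \<omega>. \<omega> \<in> space M \<Longrightarrow> Wv Z i \<omega> $ g = 0 \<or> Wv Z i \<omega> $ g = 1"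
    and "\<And>i \<omega>. \<omega> \<in> space M \<Longrightarrow> (\<Sum>g\<in>UNIV. Wv Z i \<omega> $ g) = 1"
    and "\<And>g. rho M Z g > 0"
    and "prob_space.indep_set M
           {Wv Z 0 -` A \<inter> space M | A. A \<in> sets borel}
           {(\<lambda>\<omega>. (Yv Z 0 \<omega>, Xv Z 0 \<omega>)) -` B \<inter> space M | B. B \<in> sets borel}"
    and "\<And>g. integrable M (\<lambda>\<omega>. (Yv Z 0 \<omega> $ g)\<^sup>2)"
    and "integrable M (\<lambda>\<omega>. (norm (Xv Z 0 \<omega>))\<^sup>2)"
  shows "op1 M (\<lambda>N \<omega>. sqrt (real N) *\<^sub>R (ols_mu Z N \<omega> - muY M Z)
           - (1 / sqrt (real N)) *\<^sub>R (\<Sum>i<N. Fv M Z i \<omega> + Kv M Z i \<omega> + Qv M Z i \<omega>))"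
proof -
  interpret prob_space M by fact
  interpret randomized_experiment M Z
    by unfold_locales (use assms in auto)
  show ?thesis by (rule ols_asymptotically_linear)
qed

end
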